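(* Let $d\ge 2$, let $\Lambda\subseteq\mathbb Z^d$ be finite and connected, $n\ge1$, and let $V=\{v_1,\dots,v_n\}\subseteq\Lambda^{\mathrm{in}}$ be a good set of $n$ points. For $\mathcal E\subseteq E(V)$ and $v\in V$ put $\mathcal E_v=\{f\in\mathcal E: f^-=v\}\subseteq E_v$. Then the $n$-th joint cumulants of $(X_vY_v)_{v\in V}$ under the Dirichlet fermionic Gaussian free field are $$\kappa^{\mathbf 0}_\Lambda(X_vY_v:v\in V)=\Bigl(\frac{-1}{2d}\Bigr)^n\sum_{\substack{\mathcal E\subseteq E(V)\\ |\mathcal E_v|\ge1\ \forall v\in V}}K(\mathcal E)\sum_{\tau\in S_{\mathrm{co}}(\mathcal E)}\mathrm{sign}(\tau)\prod_{f\in\mathcal E}M(f,\tau(f)),$$ where $K(\mathcal E)=\prod_{v\in V}K(\mathcal E_v)$ and $K(\mathcal E_v)=(-1)^{|\mathcal E_v|}|\mathcal E_v|$.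
   Context: Lattice. $e_1,\dots,e_d$ are the standard basis vectors, $e_{d+i}=-e_i$. $E_v$ is the set of the $2d$ directed edges $(v,v+e_i)$ and $E(V)=\bigcup_{v\in V}E_v$; an edge $f=(f^-,f^+)$ has tail $f^-$ and tip $f^+$, and $\eta^*(f)=f^+-f^-\in\{e_1,\dots,e_{2d}\}$. $\Lambda^{\mathrm{in}}$ is the set of points of $\Lambda$ all of whose nearest neighbours lie in $\Lambda$. $\Delta_\Lambda(u,v)$ ($u,v\in\Lambda$) is $-2d$ if $u=v$, $1$ if nearest neighbours, $0$ otherwise; $G_\Lambda=(-\Delta_\Lambda)^{-1}$, extended by $0$ when an argument is outside $\Lambda$. $\nabla^{(1)}_{e}\nabla^{(2)}_{e'}f(u,v)=f(u+e,v+e')-f(u+e,v)-f(u,v+e')+f(u,v)$. $M(f,f')=\nabla^{(1)}_{\eta^*(f)}\nabla^{(2)}_{\eta^*(f')}G_\Lambda(f^-,f'^-)$. $\Lambda^g$ is the graph obtained by identifying all vertices outside $\Lambda$ adjacent to $\Lambda$ with a ghost vertex $g$. $A\subseteq\Lambda$ is good if no two points of $A$ are nearest neighbours and each $v\in\Lambda\setminus A$ is joined to $g$ by a nearest-neighbour path in $\Lambda^g$ disjoint from $A$. Connected permutations. For $\mathcal E\subseteq E(V)$ with every $\mathcal E_v\ne\emptyset$ and a permutation $\tau$ of $\mathcal E$, let $V_\tau$ be the multigraph on $V$ having, for each pair $v\ne w$, one edge between $v$ and $w$ for each $f\in\mathcal E_v,f'\in\mathcal E_w$ with $\tau(f)=f'$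 or $\tau(f')=f$. $\tau$ is connected if $V_\tau$ is connected; $S_{\mathrm{co}}(\mathcal E)$ is the set of connected permutations of $\mathcal E$. Grassmann algebra. $\Omega^{2\Lambda}$ is the real Grassmann algebra with generators $\psi_v,\bar\psi_v$, $v\in\Lambda$ (pairwise anticommuting, squares zero). $\partial_\xi$ is the left derivative: on a monomial $\xi_{i_1}\cdots\xi_{i_p}$ with $\xi=\xi_{i_\alpha}$ it gives $(-1)^{\alpha-1}$ times the monomial with $\xi_{i_\alpha}$ removed; $0$ if $\xi$ does not occur. $\exp$ is defined by its (finite) power series. Dirichlet fermionic Gaussian free field state: $$\langle F\rangle^{\mathbf 0}_\Lambda=\frac1{\det(-\Delta_\Lambda)}\Bigl(\prod_{v\in\Lambda}\partial_{\bar\psi_v}\partial_{\psi_v}\Bigr)\exp\Bigl(\sum_{u,v\in\Lambda}\psi_u(-\Delta_\Lambda(u,v))\bar\psi_v\Bigr)F .$$ With $\nabla_{e_i}\psi(v)=\psi_{v+e_i}-\psi_v$ and likewise for $\bar\psi$: $X_v=\frac1{2d}\sum_{i=1}^{2d}\nabla_{e_i}\psi(v)\nabla_{e_i}\bar\psi(v)$, $Y_v=\prod_{i=1}^{2d}(1-\nabla_{e_i}\psi(v)\nabla_{e_i}\bar\psi(v))$. $\kappa^{\mathbf 0}_\Lambda(W_v:v\in V)=\sum_{\pi\in\Pi(V)}(|\pi|-1)!\,(-1)^{|\pi|-1}\prod_{B\in\pi}\langle\prod_{v\in B}W_v\rangle^{\mathbf 0}_\Lambda$, $\Pi(V)$ the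 set of partitions of $V$. *)

theory Defs
  imports
    "HOL-Analysis.Finite_Cartesian_Product"
    "HOL-Library.Countable"
    "HOL-Library.Disjoint_Sets"
    "HOL-Combinatorics.Permutations"
begin

section \<open>Grassmann algebras\<close>

text \<open>
  An element is given by its coefficients with respect to the monomials \<open>\<xi>\<^sub>S\<close>, where \<open>S\<close> is a finite
  set of generators and \<open>\<xi>\<^sub>S\<close> is the product of the elements of \<open>S\<close> in increasing order. The order
  on the generators (induced by \<open>to_nat\<close>) only serves to choose this basis.
\<close>

typedef 'a grassmann =
  "{F :: 'a set \<Rightarrow> real. finite {S. F S \<noteq> 0} \<and> (\<forall>S. F S \<noteq> 0 \<longrightarrow> finite S)}"
  morphisms coeff Abs_grassmann
  by (rule exI[of _ "\<lambda>_. 0"]) simp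

setup_lifting type_definition_grassmann

lemma finite_coeff_support: "finite {S. coeff F S \<noteq> 0}"
  using coeff[of F] by simp

lemma coeff_infinite: "infinite S \<Longrightarrow> coeff F S = 0"
  using coeff[of F] by auto

lemma grassmann_eqI:
  assumes "\<And>S. finite S \<Longrightarrow> coeff F S = coeff G S"
  shows "F = G"
proof -
  have "coeff F S = coeff G S" for S
    by (cases "finite S") (auto simp: assms coeff_infinite)
  then show ?thesis by (simp add: coeff_inject[symmetric] ext)
qed

text \<open>For disjoint \<open>S\<close> and \<open>T\<close> one has \<open>\<xi>\<^sub>S \<xi>\<^sub>T = shuffle_sign S T \<xi>\<^bsub>S \<union> T\<^esub>\<close>.\<close>

definition shuffle_sign :: "'a::countable set \<Rightarrow> 'a set \<Rightarrow> real" where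
  "shuffle_sign S T = (- 1) ^ card {(s, t). s \<in> S \<and> t \<in> T \<and> to_nat t < to_nat s}"

lemma finite_inversions:
  "finite S \<Longrightarrow> finite T \<Longrightarrow> finite {(s, t). s \<in> S \<and> t \<in> T \<and> to_nat t < to_nat s}"
  by (rule finite_subset[of _ "S \<times> T"]) auto

lemma shuffle_sign_Un_left:
  assumes "finite S" "finite T" "finite U" "S \<inter> T = {}"
  shows "shuffle_sign (S \<union> T) U = shuffle_sign S U * shuffle_sign T U"
proof -
  have "{(s, t). s \<in> S \<union> T \<and> t \<in> U \<and> to_nat t < to_nat s} =
     {(s, t). s \<in> S \<and> t \<in> U \<and> to_nat t < to_nat s} \<union>
     {(s, t). s \<in> T \<and> t \<in> U \<and> to_nat t < to_nat s}" by auto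
  then show ?thesis
    unfolding shuffle_sign_def power_add[symmetric]
    using assms by (subst card_Un_disjoint[symmetric]) (auto simp: finite_inversions)
qed

lemma shuffle_sign_Un_right:
  assumes "finite S" "finite T" "finite U" "T \<inter> U = {}"
  shows "shuffle_sign S (T \<union> U) = shuffle_sign S T * shuffle_sign S U"
proof -
  have "{(s, t). s \<in> S \<and> t \<in> T \<union> U \<and> to_nat t < to_nat s} =
     {(s, t). s \<in> S \<and> t \<in> T \<and> to_nat t < to_nat s} \<union>
     {(s, t). s \<in> S \<and> t \<in> U \<and> to_nat t < to_nat s}" by auto
  then show ?thesis
    unfolding shuffle_sign_def power_add[symmetric]
    using assms by (subst card_Un_disjoint[symmetric]) (auto simp: finite_inversions)
qed

lemma shuffle_sign_empty [simp]: "shuffle_sign {} T = 1" "shuffle_sign S {} = 1"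
  by (simp_all add: shuffle_sign_def)

instantiation grassmann :: (countable) real_algebra_1
begin

lift_definition zero_grassmann :: "'a grassmann" is "\<lambda>_. 0" by simp

lift_definition one_grassmann :: "'a grassmann" is "\<lambda>S. if S = {} then 1 else 0" by simp

lift_definition plus_grassmann :: "'a grassmann \<Rightarrow> 'a grassmann \<Rightarrow> 'a grassmann"
  is "\<lambda>F G S. F S + G S"
proof -
  fix F G :: "'a set \<Rightarrow> real"
  assume F: "finite {S. F S \<noteq> 0} \<and> (\<forall>S. F S \<noteq> 0 \<longrightarrow> finite S)"
    and G: "finite {S. G S \<noteq> 0} \<and> (\<forall>S. G S \<noteq> 0 \<longrightarrow> finite S)"
  have "finite {S. F S + G S \<noteq> 0}"
    using F G by - (rule finite_subset[of _ "{S. F S \<noteq> 0} \<union> {S. G S \<noteq> 0}"], auto)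
  moreover have "finite S" if "F S + G S \<noteq> 0" for S
    using F G that by (metis add.right_neutral)
  ultimately show "finite {S. F S + G S \<noteq> 0} \<and> (\<forall>S. F S + G S \<noteq> 0 \<longrightarrow> finite S)" by blast
qed

lift_definition uminus_grassmann :: "'a grassmann \<Rightarrow> 'a grassmann" is "\<lambda>F S. - F S" by simp

lift_definition scaleR_grassmann :: "real \<Rightarrow> 'a grassmann \<Rightarrow> 'a grassmann" is "\<lambda>r F S. r * F S"
  by (auto elim: finite_subset[rotated])

definition minus_grassmann :: "'a grassmann \<Rightarrow> 'a grassmann \<Rightarrow> 'a grassmann" where
  "minus_grassmann F G = F + - G"

lift_definition times_grassmann :: "'a grassmann \<Rightarrow> 'a grassmann \<Rightarrow> 'a grassmann"
  is "\<lambda>F G S. \<Sum>T\<in>Pow S. shuffle_sign T (S - T) * F T * G (S - T)"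
proof -
  fix F G :: "'a set \<Rightarrow> real"
  assume F: "finite {S. F S \<noteq> 0} \<and> (\<forall>S. F S \<noteq> 0 \<longrightarrow> finite S)"
    and G: "finite {S. G S \<noteq> 0} \<and> (\<forall>S. G S \<noteq> 0 \<longrightarrow> finite S)"
  let ?H = "\<lambda>S. \<Sum>T\<in>Pow S. shuffle_sign T (S - T) * F T * G (S - T)"
  have "S \<in> (\<lambda>(T, U). T \<union> U) ` ({S. F S \<noteq> 0} \<times> {S. G S \<noteq> 0})" if S: "?H S \<noteq> 0" for S
  proof -
    from sum.not_neutral_contains_not_neutral[OF S] obtain T
      where T: "T \<in> Pow S" "shuffle_sign T (S - T) * F T * G (S - T) \<noteq> 0" by blast
    then show ?thesis by (intro image_eqI[of _ _ "(T, S - T)"]) auto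
  qed
  then have "finite {S. ?H S \<noteq> 0}"
    using F G by - (rule finite_subset[of _ "(\<lambda>(T, U). T \<union> U) ` ({S. F S \<noteq> 0} \<times> {S. G S \<noteq> 0})"], auto)
  moreover have "finite S" if S: "?H S \<noteq> 0" for S
    using S by (cases "finite S") auto
  ultimately show "finite {S. ?H S \<noteq> 0} \<and> (\<forall>S. ?H S \<noteq> 0 \<longrightarrow> finite S)" by blast
qed

lemma grassmann_mult_assoc: "(F * G) * H = F * (G * H)" for F G H :: "'a grassmann"
proof (rule grassmann_eqI)
  fix S :: "'a set" assume S: "finite S"
  have fin: "finite T" if "T \<subseteq> S" for T using S that finite_subset by blast
  have "coeff ((F * G) * H) S = (\<Sum>T\<in>Pow S. \<Sum>A\<in>Pow T. shuffle_sign T (S - T) *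
      shuffle_sign A (T - A) * coeff F A * coeff G (T - A) * coeff H (S - T))"
    by (simp add: times_grassmann.rep_eq sum_distrib_left sum_distrib_right mult_ac)
  also have "\<dots> = (\<Sum>(T, A)\<in>(SIGMA T:Pow S. Pow T). shuffle_sign T (S - T) *
      shuffle_sign A (T - A) * coeff F A * coeff G (T - A) * coeff H (S - T))"
    using S by (subst sum.Sigma) (auto simp: fin)
  also have "\<dots> = (\<Sum>(A, B)\<in>(SIGMA A:Pow S. Pow (S - A)). shuffle_sign A (S - A) *
      shuffle_sign B (S - A - B) * coeff F A * coeff G B * coeff H (S - A - B))"
  proof (rule sum.reindex_bij_witness[where i = "\<lambda>(A, B). (A \<union> B, A)" and j = "\<lambda>(T, A). (A, T - A)"])
    fix a assume "a \<in> (SIGMA T:Pow S. Pow T)"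
    then obtain T A where a: "a = (T, A)" "T \<subseteq> S" "A \<subseteq> T" by auto
    define B where "B = T - A"
    define C where "C = S - T"
    have e: "T = A \<union> B" "S - A = B \<union> C" "S - A - B = C" "A \<inter> B = {}" "B \<inter> C = {}"
      using a by (auto simp: B_def C_def)
    have f: "finite A" "finite B" "finite C" using a fin by (auto simp: B_def C_def)
    have "shuffle_sign T C * shuffle_sign A B = shuffle_sign A (S - A) * shuffle_sign B C"
      unfolding e(1,2) using f e by (simp add: shuffle_sign_Un_left shuffle_sign_Un_right)
    then show "(case (case a of (T, A) \<Rightarrow> (A, T - A)) of (A, B) \<Rightarrow> shuffle_sign A (S - A) *
      shuffle_sign B (S - A - B) * coeff F A * coeff G B * coeff H (S - A - B)) =
      (case a of (T, A) \<Rightarrow> shuffle_sign T (S - T) *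
      shuffle_sign A (T - A) * coeff F A * coeff G (T - A) * coeff H (S - T))"
      using a(1) by (simp add: B_def[symmetric] C_def[symmetric] e(3))
  qed auto
  also have "\<dots> = (\<Sum>A\<in>Pow S. \<Sum>B\<in>Pow (S - A). shuffle_sign A (S - A) *
      shuffle_sign B (S - A - B) * coeff F A * coeff G B * coeff H (S - A - B))"
    using S by (subst sum.Sigma) auto
  also have "\<dots> = coeff (F * (G * H)) S"
    by (simp add: times_grassmann.rep_eq sum_distrib_left sum_distrib_right mult_ac)
  finally show "coeff ((F * G) * H) S = coeff (F * (G * H)) S" .
qed

instance
proof
  fix F G H :: "'a grassmann" and r s :: real
  show "(F * G) * H = F * (G * H)" by (rule grassmann_mult_assoc)
  show "1 * F = F"
  proof (rule grassmann_eqI)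
    fix S :: "'a set" assume S: "finite S"
    have "coeff (1 * F) S = (\<Sum>T\<in>Pow S. if T = {} then coeff F S else 0)"
      unfolding times_grassmann.rep_eq by (rule sum.cong) (auto simp: one_grassmann.rep_eq)
    then show "coeff (1 * F) S = coeff F S" using S by simp
  qed
  show "F * 1 = F"
  proof (rule grassmann_eqI)
    fix S :: "'a set" assume S: "finite S"
    have "coeff (F * 1) S = (\<Sum>T\<in>Pow S. if T = S then coeff F S else 0)"
      unfolding times_grassmann.rep_eq by (rule sum.cong) (auto simp: one_grassmann.rep_eq)
    then show "coeff (F * 1) S = coeff F S" using S by simp
  qed
  show "(0 :: 'a grassmann) \<noteq> 1"
    by transfer (metis zero_neq_one)
qed (auto intro!: grassmann_eqI simp: plus_grassmann.rep_eq zero_grassmann.rep_eq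
    uminus_grassmann.rep_eq scaleR_grassmann.rep_eq minus_grassmann_def times_grassmann.rep_eq
    sum.distrib sum_distrib_left algebra_simps)

end

lemma coeff_uminus: "coeff (- F) S = - coeff F S"
  by (simp add: uminus_grassmann.rep_eq)

lemma coeff_diff: "coeff (F - G) S = coeff F S - coeff G S"
  by (simp only: minus_grassmann_def plus_grassmann.rep_eq uminus_grassmann.rep_eq)

lift_definition generator :: "'a \<Rightarrow> 'a::countable grassmann"
  is "\<lambda>x S. if S = {x} then 1 else 0" by simp

text \<open>If \<open>x\<close> has position \<open>\<alpha>\<close> in \<open>\<xi>\<^bsub>insert x S\<^esub>\<close>, this is \<open>(-1)\<close> to the power \<open>\<alpha> - 1\<close>.\<close>

definition position_sign :: "'a::countable \<Rightarrow> 'a set \<Rightarrow> real" where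
  "position_sign x S = (- 1) ^ card {y \<in> S. to_nat y < to_nat x}"

lemma position_sign_empty [simp]: "position_sign x {} = 1"
  by (simp add: position_sign_def)

lemma position_sign_square [simp]: "position_sign x S * position_sign x S = 1"
  "position_sign x S * (position_sign x S * r) = r"
  by (simp_all add: position_sign_def)

lemma position_sign_insert:
  assumes "finite S" "x \<notin> S"
  shows "position_sign y (insert x S) = (if to_nat x < to_nat y then - 1 else 1) * position_sign y S"
proof (cases "to_nat x < to_nat y")
  case True
  then have "{z \<in> insert x S. to_nat z < to_nat y} = insert x {z \<in> S. to_nat z < to_nat y}"
    by auto
  then show ?thesis using True assms by (simp add: position_sign_def)
next
  case False
  then have "{z \<in> insert x S. to_nat z < to_nat y} = {z \<in> S. to_nat z < to_nat y}" by auto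
  then show ?thesis using False by (simp add: position_sign_def)
qed

lift_definition left_deriv :: "'a::countable \<Rightarrow> 'a grassmann \<Rightarrow> 'a grassmann"
  is "\<lambda>x F S. if x \<in> S then 0 else position_sign x S * F (insert x S)"
proof -
  fix x :: 'a and F :: "'a set \<Rightarrow> real"
  assume F: "finite {S. F S \<noteq> 0} \<and> (\<forall>S. F S \<noteq> 0 \<longrightarrow> finite S)"
  let ?D = "\<lambda>S. if x \<in> S then 0 else position_sign x S * F (insert x S)"
  have "{S. ?D S \<noteq> 0} \<subseteq> (\<lambda>S. S - {x}) ` {S. F S \<noteq> 0}"
  proof
    fix S assume "S \<in> {S. ?D S \<noteq> 0}"
    then show "S \<in> (\<lambda>S. S - {x}) ` {S. F S \<noteq> 0}"
      by (intro image_eqI[of _ _ "insert x S"]) (auto split: if_splits)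
  qed
  then have "finite {S. ?D S \<noteq> 0}" by (rule finite_subset) (simp add: F)
  moreover have "\<forall>S. ?D S \<noteq> 0 \<longrightarrow> finite S" using F by (auto split: if_splits)
  ultimately show "finite {S. ?D S \<noteq> 0} \<and> (\<forall>S. ?D S \<noteq> 0 \<longrightarrow> finite S)" by blast
qed

lemma coeff_generator_mult:
  assumes "finite S"
  shows "coeff (generator y * F) S =
    (if y \<in> S then position_sign y S * coeff F (S - {y}) else 0)"
proof -
  have "coeff (generator y * F) S =
      (\<Sum>T\<in>Pow S. if T = {y} then shuffle_sign {y} (S - {y}) * coeff F (S - {y}) else 0)"
    unfolding times_grassmann.rep_eq by (rule sum.cong) (auto simp: generator.rep_eq)
  also have "\<dots> = (if y \<in> S then shuffle_sign {y} (S - {y}) * coeff F (S - {y}) else 0)"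
    using assms by simp
  also have "shuffle_sign {y} (S - {y}) = position_sign y S"
  proof -
    have "{(s, t). s \<in> {y} \<and> t \<in> S - {y} \<and> to_nat t < to_nat s} =
        Pair y ` {z \<in> S. to_nat z < to_nat y}" by auto
    then show ?thesis
      unfolding shuffle_sign_def position_sign_def by (simp add: card_image inj_on_def)
  qed
  finally show ?thesis .
qed

lemma left_deriv_one: "left_deriv x 1 = 0"
  by (rule grassmann_eqI) (simp add: left_deriv.rep_eq one_grassmann.rep_eq zero_grassmann.rep_eq)

lemma left_deriv_generator_mult:
  "left_deriv x (generator y * F) = (if x = y then F else 0) - generator y * left_deriv x F"
proof (rule grassmann_eqI)
  fix S :: "'a set" assume S: "finite S"
  show "coeff (left_deriv x (generator y * F)) S =
      coeff ((if x = y then F else 0) - generator y * left_deriv x F) S"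
  proof (cases "x = y")
    case True
    show ?thesis
    proof (cases "x \<in> S")
      case False
      then show ?thesis using S True
        by (auto simp: coeff_diff left_deriv.rep_eq coeff_generator_mult position_sign_insert)
    next
      case xS: True
      define R where "R = S - {x}"
      have "S = insert x R" "x \<notin> R" "finite R" using xS S by (auto simp: R_def)
      then show ?thesis using True
        by (auto simp: coeff_diff left_deriv.rep_eq coeff_generator_mult position_sign_insert)
    qed
  next
    case ne: False
    show ?thesis
    proof (cases "x \<notin> S \<and> y \<in> S")
      case True
      define R where "R = S - {y}"
      have R: "S = insert y R" "y \<notin> R" "x \<notin> R" "finite R" using True S by (auto simp: R_def)
      have e: "insert x (insert y R) - {y} = insert x R" using R ne by auto
      have o: "to_nat x < to_nat y \<or> to_nat y < to_nat x" using ne by (simp add: linorder_neq_iff[symmetric])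
      show ?thesis
        using R ne o
        by (auto simp: coeff_diff zero_grassmann.rep_eq left_deriv.rep_eq coeff_generator_mult coeff_uminus e
            position_sign_insert)
    next
      case False
      then show ?thesis using S ne
        by (auto simp: coeff_diff zero_grassmann.rep_eq left_deriv.rep_eq coeff_generator_mult coeff_uminus)
    qed
  qed
qed

lemma generator_anticommute: "generator x * generator y = - (generator y * generator x)"
proof (rule grassmann_eqI)
  fix S :: "'a set" assume S: "finite S"
  show "coeff (generator x * generator y) S = coeff (- (generator y * generator x)) S"
  proof (cases "x \<noteq> y \<and> S = {x, y}")
    case True
    then have e: "{x, y} - {x} = {y}" "{x, y} - {y} = {x}" by auto
    have "to_nat x < to_nat y \<or> to_nat y < to_nat x"
      using True by (simp add: linorder_neq_iff[symmetric])
    then show ?thesis using True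
      by (auto simp: coeff_uminus coeff_generator_mult generator.rep_eq e position_sign_insert)
  next
    case False
    then have "\<not> (x \<in> S \<and> S - {x} = {y})" "\<not> (y \<in> S \<and> S - {y} = {x})" by auto
    then show ?thesis using S
      by (auto simp: coeff_uminus coeff_generator_mult generator.rep_eq)
  qed
qed

lemma left_deriv_anticommute: "left_deriv x (left_deriv y F) = - left_deriv y (left_deriv x F)"
proof (rule grassmann_eqI)
  fix S :: "'a set" assume S: "finite S"
  show "coeff (left_deriv x (left_deriv y F)) S = coeff (- left_deriv y (left_deriv x F)) S"
  proof (cases "x \<noteq> y \<and> x \<notin> S \<and> y \<notin> S")
    case True
    then have "to_nat x < to_nat y \<or> to_nat y < to_nat x" by (simp add: linorder_neq_iff[symmetric])
    then show ?thesis using S True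
      by (auto simp: coeff_uminus left_deriv.rep_eq position_sign_insert insert_commute)
  next
    case False
    then show ?thesis by (auto simp: coeff_uminus left_deriv.rep_eq)
  qed
qed

text \<open>For nilpotent \<open>F\<close> the index set is finite and this is the exponential series.\<close>

definition grassmann_exp :: "'a::countable grassmann \<Rightarrow> 'a grassmann" where
  "grassmann_exp F = (\<Sum>k\<in>{k. F ^ k \<noteq> 0}. (1 / fact k) *\<^sub>R F ^ k)"

text \<open>Only used for pairwise commuting factors, so that the order of the product is immaterial.\<close>

definition commuting_prod :: "('i \<Rightarrow> 'a::countable grassmann) \<Rightarrow> 'i set \<Rightarrow> 'a grassmann" where
  "commuting_prod W B = Finite_Set.fold (\<lambda>i. (*) (W i)) 1 B"

lemma commuting_prod_empty [simp]: "commuting_prod W {} = 1"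
  by (simp add: commuting_prod_def)

lemma commuting_prod_insert:
  assumes "\<And>i j. W i * W j = W j * W i" "finite B" "i \<notin> B"
  shows "commuting_prod W (insert i B) = W i * commuting_prod W B"
proof -
  interpret comp_fun_commute "\<lambda>i. (*) (W i)"
    by standard (simp add: fun_eq_iff mult.assoc[symmetric] assms(1))
  show ?thesis using assms(2,3) by (simp add: commuting_prod_def)
qed

lemma commuting_prod_commute:
  assumes "\<And>i j. W i * W j = W j * W i" "\<And>i. W i * F = F * W i" "finite B"
  shows "commuting_prod W B * F = F * commuting_prod W B"
  using assms(3)
proof (induction B)
  case (insert i B)
  have "commuting_prod W (insert i B) * F = W i * (commuting_prod W B * F)"
    using insert.hyps by (simp add: commuting_prod_insert[OF assms(1)] mult.assoc)
  also have "\<dots> = (W i * F) * commuting_prod W B" by (simp only: insert.IH mult.assoc)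
  also have "\<dots> = F * commuting_prod W (insert i B)"
    unfolding assms(2) using insert.hyps by (simp add: commuting_prod_insert[OF assms(1)] mult.assoc)
  finally show ?case .
qed simp


section \<open>The lattice and its Green function\<close>

definition unit_vectors :: "(int ^ 'd) set" where
  "unit_vectors = range (\<lambda>i. axis i 1) \<union> range (\<lambda>i. - axis i 1)"

definition nearest_neighbours :: "int ^ 'd \<Rightarrow> int ^ 'd \<Rightarrow> bool" where
  "nearest_neighbours u v \<longleftrightarrow> v - u \<in> unit_vectors"

definition lattice_connected :: "(int ^ 'd) set \<Rightarrow> bool" where
  "lattice_connected L \<longleftrightarrow>
    (\<forall>u\<in>L. \<forall>v\<in>L. (u, v) \<in> {(x, y). x \<in> L \<and> y \<in> L \<and> nearest_neighbours x y}\<^sup>*)"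

definition lattice_interior :: "(int ^ 'd) set \<Rightarrow> (int ^ 'd) set" where
  "lattice_interior L = {v \<in> L. \<forall>w. nearest_neighbours v w \<longrightarrow> w \<in> L}"

text \<open>In the graph with ghost vertex, \<open>None\<close> is the ghost.\<close>

definition ghost_vertex_map :: "(int ^ 'd) set \<Rightarrow> int ^ 'd \<Rightarrow> (int ^ 'd) option" where
  "ghost_vertex_map L v = (if v \<in> L then Some v else None)"

definition ghost_graph_edges :: "(int ^ 'd) set \<Rightarrow> ((int ^ 'd) option \<times> (int ^ 'd) option) set" where
  "ghost_graph_edges L = {(ghost_vertex_map L u, ghost_vertex_map L v) | u v.
    nearest_neighbours u v \<and> (u \<in> L \<or> v \<in> L)}"

definition good_set :: "(int ^ 'd) set \<Rightarrow> (int ^ 'd) set \<Rightarrow> bool" where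
  "good_set L A \<longleftrightarrow> A \<subseteq> L \<and>
    (\<forall>u\<in>A. \<forall>v\<in>A. \<not> nearest_neighbours u v) \<and>
    (\<forall>v\<in>L - A. (Some v, None) \<in>
      {(x, y) \<in> ghost_graph_edges L. x \<notin> Some ` A \<and> y \<notin> Some ` A}\<^sup>*)"

text \<open>The Dirichlet Laplacian of \<open>L\<close> is the restriction of the following matrix to \<open>L \<times> L\<close>.\<close>

definition laplacian :: "int ^ 'd \<Rightarrow> int ^ 'd \<Rightarrow> real" where
  "laplacian u v =
    (if u = v then - 2 * real CARD('d) else if nearest_neighbours u v then 1 else 0)"

text \<open>Determinant and inverse of the square matrix \<open>(A u v)\<close> indexed by a finite set \<open>L\<close>.\<close>

definition det_on :: "'a set \<Rightarrow> ('a \<Rightarrow> 'a \<Rightarrow> real) \<Rightarrow> real" where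
  "det_on L A = (\<Sum>p | p permutes L. of_int (sign p) * (\<Prod>u\<in>L. A u (p u)))"

definition inverse_on :: "'a set \<Rightarrow> ('a \<Rightarrow> 'a \<Rightarrow> real) \<Rightarrow> 'a \<Rightarrow> 'a \<Rightarrow> real" where
  "inverse_on L A = (THE B.
    (\<forall>u v. u \<notin> L \<or> v \<notin> L \<longrightarrow> B u v = 0) \<and>
    (\<forall>u\<in>L. \<forall>v\<in>L. (\<Sum>w\<in>L. A u w * B w v) = of_bool (u = v)) \<and>
    (\<forall>u\<in>L. \<forall>v\<in>L. (\<Sum>w\<in>L. B u w * A w v) = of_bool (u = v)))"

definition green_function :: "(int ^ 'd) set \<Rightarrow> int ^ 'd \<Rightarrow> int ^ 'd \<Rightarrow> real" where
  "green_function L = inverse_on L (\<lambda>u v. - laplacian u v)"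

definition mixed_difference ::
    "int ^ 'd \<Rightarrow> int ^ 'd \<Rightarrow> (int ^ 'd \<Rightarrow> int ^ 'd \<Rightarrow> real) \<Rightarrow> int ^ 'd \<Rightarrow> int ^ 'd \<Rightarrow> real" where
  "mixed_difference e e' f u v = f (u + e) (v + e') - f (u + e) v - f u (v + e') + f u v"


section \<open>Edge sets and connected permutations\<close>

text \<open>A directed edge is the pair of its tail and its tip.\<close>

definition edge_direction :: "(int ^ 'd) \<times> (int ^ 'd) \<Rightarrow> int ^ 'd" where
  "edge_direction f = snd f - fst f"

definition star_edges :: "int ^ 'd \<Rightarrow> ((int ^ 'd) \<times> (int ^ 'd)) set" where
  "star_edges v = {(v, v + e) | e. e \<in> unit_vectors}"

definition edges_from :: "(int ^ 'd) set \<Rightarrow> ((int ^ 'd) \<times> (int ^ 'd)) set" where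
  "edges_from V = (\<Union>v\<in>V. star_edges v)"

definition edges_at :: "('v \<times> 'v) set \<Rightarrow> 'v \<Rightarrow> ('v \<times> 'v) set" where
  "edges_at E v = {f \<in> E. fst f = v}"

definition edge_kernel ::
    "(int ^ 'd) set \<Rightarrow> (int ^ 'd) \<times> (int ^ 'd) \<Rightarrow> (int ^ 'd) \<times> (int ^ 'd) \<Rightarrow> real" where
  "edge_kernel L f f' =
    mixed_difference (edge_direction f) (edge_direction f') (green_function L) (fst f) (fst f')"

definition local_weight :: "'e set \<Rightarrow> real" where
  "local_weight F = (- 1) ^ card F * real (card F)"

definition edge_set_weight :: "'v set \<Rightarrow> ('v \<times> 'v) set \<Rightarrow> real" where
  "edge_set_weight V E = (\<Prod>v\<in>V. local_weight (edges_at E v))"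

text \<open>The edges joining \<open>v \<noteq> w\<close> in the multigraph of a permutation \<open>\<tau>\<close> of \<open>E\<close>.\<close>

definition multigraph_edges ::
    "('v \<times> 'v) set \<Rightarrow> ('v \<times> 'v \<Rightarrow> 'v \<times> 'v) \<Rightarrow> 'v \<Rightarrow> 'v \<Rightarrow> (('v \<times> 'v) \<times> ('v \<times> 'v)) set" where
  "multigraph_edges E \<tau> v w =
    {(f, f'). f \<in> edges_at E v \<and> f' \<in> edges_at E w \<and> (\<tau> f = f' \<or> \<tau> f' = f)}"

definition connected_permutations ::
    "'v set \<Rightarrow> ('v \<times> 'v) set \<Rightarrow> ('v \<times> 'v \<Rightarrow> 'v \<times> 'v) set" where
  "connected_permutations V E = {\<tau>. \<tau> permutes E \<and>
    (\<forall>v\<in>V. \<forall>w\<in>V. (v, w) \<in>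
      {(x, y). x \<in> V \<and> y \<in> V \<and> x \<noteq> y \<and> multigraph_edges E \<tau> x y \<noteq> {}}\<^sup>*)}"


section \<open>The fermionic Gaussian free field\<close>

datatype 'v fermion = Psi 'v | Psi_bar 'v

instance fermion :: (countable) countable
  by countable_datatype

text \<open>
  The fermions are indexed by all of the lattice; the Grassmann algebra of a finite set \<open>L\<close> of sites is
  the subalgebra generated by the fermions at the sites in \<open>L\<close>. On this subalgebra the integral
  below takes values in the multiples of \<open>1\<close>, and the state reads off the scalar.
\<close>

definition grassmann_integral :: "'v::countable set \<Rightarrow> 'v fermion grassmann \<Rightarrow> 'v fermion grassmann" where
  "grassmann_integral L F =
    Finite_Set.fold (\<lambda>v. left_deriv (Psi_bar v) \<circ> left_deriv (Psi v)) F L"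

lemma comp_fun_commute_integral:
  "comp_fun_commute (\<lambda>v. left_deriv (Psi_bar v) \<circ> left_deriv (Psi v))"
proof -
  have neg: "left_deriv x (- F) = - left_deriv x F" for x :: "'a fermion" and F
    by (rule grassmann_eqI) (simp add: left_deriv.rep_eq coeff_uminus)
  have "left_deriv (Psi_bar v) (left_deriv (Psi v) (left_deriv (Psi_bar w) (left_deriv (Psi w) F))) =
    left_deriv (Psi_bar w) (left_deriv (Psi w) (left_deriv (Psi_bar v) (left_deriv (Psi v) F)))"
    for v w :: 'a and F
    by (simp only: neg minus_minus left_deriv_anticommute[of "Psi v" "Psi_bar w"]
        left_deriv_anticommute[of "Psi v" "Psi w"] left_deriv_anticommute[of "Psi_bar v" "Psi_bar w"]
        left_deriv_anticommute[of "Psi_bar v" "Psi w"])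
  then show ?thesis by unfold_locales (simp add: fun_eq_iff)
qed

definition gff_state :: "(int ^ 'd) set \<Rightarrow> (int ^ 'd) fermion grassmann \<Rightarrow> real" where
  "gff_state L F =
    1 / det_on L (\<lambda>u v. - laplacian u v) *
    coeff (grassmann_integral L
      (grassmann_exp (\<Sum>u\<in>L. \<Sum>v\<in>L.
        (- laplacian u v) *\<^sub>R (generator (Psi u) * generator (Psi_bar v))) * F)) {}"

definition grad_psi :: "int ^ 'd \<Rightarrow> int ^ 'd \<Rightarrow> (int ^ 'd) fermion grassmann" where
  "grad_psi e v = generator (Psi (v + e)) - generator (Psi v)"

definition grad_psi_bar :: "int ^ 'd \<Rightarrow> int ^ 'd \<Rightarrow> (int ^ 'd) fermion grassmann" where
  "grad_psi_bar e v = generator (Psi_bar (v + e)) - generator (Psi_bar v)"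

definition X_field :: "int ^ 'd \<Rightarrow> (int ^ 'd) fermion grassmann" where
  "X_field v = (1 / (2 * real CARD('d))) *\<^sub>R (\<Sum>e\<in>unit_vectors. grad_psi e v * grad_psi_bar e v)"

definition Y_field :: "int ^ 'd \<Rightarrow> (int ^ 'd) fermion grassmann" where
  "Y_field v = commuting_prod (\<lambda>e. 1 - grad_psi e v * grad_psi_bar e v) unit_vectors"

definition gff_cumulant ::
    "(int ^ 'd) set \<Rightarrow> (int ^ 'd \<Rightarrow> (int ^ 'd) fermion grassmann) \<Rightarrow> (int ^ 'd) set \<Rightarrow> real" where
  "gff_cumulant L W V = (\<Sum>P | partition_on V P.
    fact (card P - 1) * (- 1) ^ (card P - 1) * (\<Prod>B\<in>P. gff_state L (commuting_prod W B)))"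

text \<open>The products in \<open>Y_field\<close> and in \<open>gff_cumulant\<close> for \<open>X_field v * Y_field v\<close> are commuting.\<close>

lemma grad_pairs_commute:
  "(grad_psi e v * grad_psi_bar e v) * (grad_psi e' v' * grad_psi_bar e' v') =
   (grad_psi e' v' * grad_psi_bar e' v') * (grad_psi e v * grad_psi_bar e v)"
proof -
  have anti: "(generator a - generator b) * (generator a' - generator b') =
      - ((generator a' - generator b') * (generator a - generator b))"
    for a b a' b' :: "(int ^ 'a) fermion"
    unfolding left_diff_distrib right_diff_distrib generator_anticommute[of a]
      generator_anticommute[of b] by simp
  have comm: "(A * B) * (C * D) = (C * D) * (A * B)"
    if "A * C = - (C * A)" "A * D = - (D * A)" "B * C = - (C * B)" "B * D = - (D * B)"
    for A B C D :: "(int ^ 'a) fermion grassmann"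
  proof -
    have "(A * B) * (C * D) = A * (B * C) * D" by (simp only: mult.assoc)
    also have "\<dots> = - ((A * C) * (B * D))" unfolding that(3) by (simp add: mult.assoc)
    also have "\<dots> = - (C * (A * D) * B)" unfolding that(1,4) by (simp add: mult.assoc)
    also have "\<dots> = (C * D) * (A * B)" unfolding that(2) by (simp add: mult.assoc)
    finally show ?thesis .
  qed
  show ?thesis
    unfolding grad_psi_def grad_psi_bar_def by (rule comm; rule anti)
qed

lemma finite_unit_vectors: "finite unit_vectors"
  by (simp add: unit_vectors_def)

lemma X_Y_field_commute:
  "(X_field v * Y_field v) * (X_field w * Y_field w) = (X_field w * Y_field w) * (X_field v * Y_field v)"
proof -
  define q :: "int ^ 'a \<Rightarrow> int ^ 'a \<Rightarrow> (int ^ 'a) fermion grassmann"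
    where "q = (\<lambda>v e. grad_psi e v * grad_psi_bar e v)"
  have qq: "q v e * q w e' = q w e' * q v e" for v w e e'
    unfolding q_def by (rule grad_pairs_commute)
  have X: "X_field v * F = F * X_field v" if "\<And>e. q v e * F = F * q v e" for v F
    unfolding X_field_def using that by (simp add: q_def sum_distrib_left sum_distrib_right)
  have Y: "Y_field v * F = F * Y_field v" if "\<And>e. q v e * F = F * q v e" for v F
    unfolding Y_field_def
    by (rule commuting_prod_commute)
      (use that qq in \<open>simp_all add: q_def finite_unit_vectors algebra_simps\<close>)
  have Xq: "q w e * X_field v = X_field v * q w e" for v w e
    by (rule X[symmetric]) (rule qq)
  have Yq: "q w e * Y_field v = Y_field v * q w e" for v w e
    by (rule Y[symmetric]) (rule qq)
  have XX: "X_field v * X_field w = X_field w * X_field v" by (rule X) (rule Xq)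
  have XY: "X_field v * Y_field w = Y_field w * X_field v" by (rule X) (rule Yq)
  have YX: "Y_field v * X_field w = X_field w * Y_field v" by (rule Y) (rule Xq)
  have YY: "Y_field v * Y_field w = Y_field w * Y_field v" by (rule Y) (rule Yq)
  have "(X_field v * Y_field v) * (X_field w * Y_field w) =
      X_field v * (Y_field v * X_field w) * Y_field w" by (simp only: mult.assoc)
  also have "\<dots> = (X_field v * X_field w) * (Y_field v * Y_field w)"
    unfolding YX by (simp only: mult.assoc)
  also have "\<dots> = X_field w * (X_field v * Y_field w) * Y_field v"
    unfolding XX YY by (simp only: mult.assoc)
  also have "\<dots> = (X_field w * Y_field w) * (X_field v * Y_field v)"
    unfolding XY by (simp only: mult.assoc)
  finally show ?thesis .
qed

end

theory Submission
  imports Defs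
begin

text \<open>
  For an edge \<open>f\<close> let \<open>q f = edge_psi f * edge_psi_bar f\<close> be the product of the gradients of \<open>\<psi>\<close> and of its
  conjugate along \<open>f\<close>. These elements commute and have square zero, so \<open>q f * (1 - q f) = q f\<close>, and
  \<open>X_field v * Y_field v\<close> is the sum over the sets \<open>F\<close> of edges at \<open>v\<close> of \<open>-1/(2d) * local_weight F\<close>
  times the product of \<open>q\<close> over \<open>F\<close> (\<open>X_Y_field_expansion\<close>). Multiplying over the points of a set \<open>B\<close>
  gives a sum over the edge sets \<open>E\<close> that start in \<open>B\<close>.

  By Wick's theorem (\<open>wick\<close>) the state maps the product of \<open>q\<close> over \<open>E\<close> to the determinant of the
  matrix \<open>edge_kernel\<close> on \<open>E\<close>. It follows from integration by parts: the integral of a derivative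
  is zero, which expresses a factor \<open>\<psi>\<close> through derivatives and the Green function, and the
  recursion obtained in this way is an expansion of the determinant along a row (\<open>det_on_insert\<close>). The same
  recursion evaluates the total Gaussian integral as the determinant of the negative Laplacian
  (\<open>berezin_psi_exp\<close>), so that the state is normalized. The Green function exists because the maximum
  principle makes the Dirichlet Laplacian injective (\<open>green_function_inverse\<close>).

  Hence the moments of the fields are sums of determinants. In the cumulant, the product of the
  determinants over the blocks of a partition is a sum over the permutations \<open>\<tau>\<close> of the edges that preserve all
  blocks (\<open>prod_det_on\<close>). After exchanging the sums, \<open>\<tau>\<close> is multiplied by the sum of
  \<open>(-1)^(|P|-1) (|P|-1)!\<close> over the partitions \<open>P\<close> whose blocks are unions of components of the
  multigraph of \<open>\<tau>\<close>. This sum is one if the multigraph is connected and zero otherwise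
  (\<open>sum_moebius_weight_connected\<close>), so only connected permutations survive (\<open>determinantal_cumulant\<close>).
\<close>

section \<open>Linear forms and products of pairs in a Grassmann algebra\<close>

definition linear_forms :: "'a::countable grassmann set" where
  "linear_forms = span (range generator)"

lemma linear_forms_anticommute:
  assumes "a \<in> linear_forms" "b \<in> linear_forms"
  shows "a * b = - (b * a)"
proof -
  have gen: "generator x * b = - (b * generator x)" for x
    using assms(2) unfolding linear_forms_def
  proof (induction b rule: span_induct_alt)
    case (step c y z)
    then obtain w where "y = generator w" by blast
    with step show ?case
      by (simp add: algebra_simps generator_anticommute[of x w])
  qed simp
  show ?thesis
    using assms(1) unfolding linear_forms_def
  proof (induction a rule: span_induct_alt)
    case (step c y z)
    then obtain w where "y = generator w" by blast
    with step gen[of w] show ?case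
      by (simp add: algebra_simps)
  qed simp
qed

lemma linear_form_square:
  fixes a :: "'a::countable grassmann"
  assumes "a \<in> linear_forms"
  shows "a * a = 0"
proof -
  have "a * a = - (a * a)" by (rule linear_forms_anticommute[OF assms assms])
  then have "(2::real) *\<^sub>R (a * a) = 0"
    by (simp add: scaleR_2 eq_neg_iff_add_eq_0)
  then show ?thesis by simp
qed

lemma pair_commutes_with_linear_form:
  assumes "a \<in> linear_forms" "b \<in> linear_forms" "c \<in> linear_forms"
  shows "(a * b) * c = c * (a * b)"
proof -
  have "(a * b) * c = - (a * c * b)"
    by (simp add: mult.assoc linear_forms_anticommute[OF assms(2,3)])
  also have "\<dots> = c * (a * b)"
    by (simp add: mult.assoc linear_forms_anticommute[OF assms(1,3)])
  finally show ?thesis .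
qed

lemma pairs_commute:
  assumes "a \<in> linear_forms" "b \<in> linear_forms" "c \<in> linear_forms" "d \<in> linear_forms"
  shows "(a * b) * (c * d) = (c * d) * (a * b)"
proof -
  have "(a * b) * (c * d) = (a * b * c) * d" by (simp only: mult.assoc)
  also have "\<dots> = c * (a * b * d)"
    by (subst pair_commutes_with_linear_form[OF assms(1,2,3)]) (simp only: mult.assoc)
  also have "\<dots> = (c * d) * (a * b)"
    by (subst pair_commutes_with_linear_form[OF assms(1,2,4)]) (simp only: mult.assoc)
  finally show ?thesis .
qed

lemma generator_linear_form [simp]: "generator x \<in> linear_forms"
  by (simp add: linear_forms_def span_base)

lemma linear_forms_combine:
  "a \<in> linear_forms \<Longrightarrow> b \<in> linear_forms \<Longrightarrow> a - b \<in> linear_forms"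
  "a \<in> linear_forms \<Longrightarrow> r *\<^sub>R a \<in> linear_forms"
  "(\<And>i. i \<in> I \<Longrightarrow> f i \<in> linear_forms) \<Longrightarrow> (\<Sum>i\<in>I. f i) \<in> linear_forms"
  by (simp_all add: linear_forms_def span_diff span_scale span_sum)

lemma left_deriv_add: "left_deriv x (F + G) = left_deriv x F + left_deriv x G"
  by (rule grassmann_eqI) (simp add: left_deriv.rep_eq plus_grassmann.rep_eq algebra_simps)

lemma left_deriv_scaleR: "left_deriv x (r *\<^sub>R F) = r *\<^sub>R left_deriv x F"
  by (rule grassmann_eqI) (simp add: left_deriv.rep_eq scaleR_grassmann.rep_eq)

lemma linear_left_deriv: "linear (left_deriv x)"
  by (intro linearI left_deriv_add left_deriv_scaleR)

lemma left_deriv_square: "left_deriv x (left_deriv x F) = 0"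
proof -
  have "(2::real) *\<^sub>R left_deriv x (left_deriv x F) = 0"
    using left_deriv_anticommute[of x x F] by (simp add: scaleR_2 eq_neg_iff_add_eq_0)
  then show ?thesis by simp
qed

lemma left_deriv_linear_form_mult:
  assumes "a \<in> linear_forms"
  shows "left_deriv x (a * F) = coeff a {x} *\<^sub>R F - a * left_deriv x F"
  using assms unfolding linear_forms_def
proof (induction a rule: span_induct_alt)
  case base
  show ?case
    by (simp add: linear_0[OF linear_left_deriv] zero_grassmann.rep_eq)
next
  case (step c y z)
  then obtain w where w: "y = generator w" by blast
  show ?case
    by (auto simp: w distrib_right left_deriv_add left_deriv_scaleR left_deriv_generator_mult
        step.IH plus_grassmann.rep_eq scaleR_grassmann.rep_eq generator.rep_eq algebra_simps)
qed

lemma left_deriv_pair_mult: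
  assumes "a \<in> linear_forms" "b \<in> linear_forms" "coeff a {x} = 0"
  shows "left_deriv x ((a * b) * F) = - (coeff b {x} *\<^sub>R (a * F)) + (a * b) * left_deriv x F"
  by (simp add: mult.assoc left_deriv_linear_form_mult assms algebra_simps)

text \<open>
  A commuting product is a fold, so its factors have to commute at all indices, and not only at those
  in \<open>K\<close>. This is why the families \<open>a\<close> and \<open>b\<close> consist of linear forms throughout.
\<close>

lemma commuting_prod_pairs_insert:
  assumes "\<And>f. a f \<in> linear_forms" "\<And>f. b f \<in> linear_forms" "finite K" "k \<notin> K"
  shows "commuting_prod (\<lambda>f. a f * b f) (insert k K) =
    (a k * b k) * commuting_prod (\<lambda>f. a f * b f) K"
  by (rule commuting_prod_insert) (use assms pairs_commute in blast)+

lemma commuting_prod_cong: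
  assumes "\<And>f. f \<in> K \<Longrightarrow> W f = W' f" "finite K"
    and "\<And>i j. W i * W j = W j * W i" "\<And>i j. W' i * W' j = W' j * W' i"
  shows "commuting_prod W K = commuting_prod W' K"
  using assms(2,1)
  by (induction K) (simp_all add: commuting_prod_insert[OF assms(3)] commuting_prod_insert[OF assms(4)])

text \<open>
  A derivative that sees only the forms \<open>b f\<close> removes one of them at a time. Putting a linear form \<open>c\<close>
  in front then amounts to writing \<open>c\<close> in the place of the removed \<open>b f\<close>: moving \<open>c\<close> across \<open>a f\<close>
  produces a sign that cancels the sign of the derivative, and all other pairs commute with \<open>c\<close>.
  For determinants this is the replacement of one column by another.
\<close>

lemma left_deriv_pair_prod:
  assumes "\<And>f. a f \<in> linear_forms" "\<And>f. b f \<in> linear_forms" "c \<in> linear_forms"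
    and "finite K" "\<And>f. f \<in> K \<Longrightarrow> coeff (a f) {x} = 0"
  shows "c * left_deriv x (commuting_prod (\<lambda>f. a f * b f) K) =
    (\<Sum>f\<in>K. coeff (b f) {x} *\<^sub>R commuting_prod (\<lambda>g. a g * (b(f := c)) g) K)"
  using assms(4,5)
proof (induction K)
  case empty
  show ?case by (simp add: left_deriv_one)
next
  case (insert k K)
  let ?P = "\<lambda>b K. commuting_prod (\<lambda>f. a f * b f) K"
  have ins: "?P b' (insert k K) = (a k * b' k) * ?P b' K" if "\<And>f. b' f \<in> linear_forms" for b'
    using that insert.hyps by (intro commuting_prod_pairs_insert assms)
  have upd: "(b(f := c)) g \<in> linear_forms" for f g using assms(2,3) by simp
  have same: "?P (b(k := c)) K = ?P b K"
    using insert.hyps by (intro commuting_prod_cong pairs_commute assms upd) auto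
  have ca: "c * a k = - (a k * c)" by (rule linear_forms_anticommute[OF assms(3,1)])
  have "c * left_deriv x (?P b (insert k K)) =
      c * (- (coeff (b k) {x} *\<^sub>R (a k * ?P b K)) + (a k * b k) * left_deriv x (?P b K))"
    unfolding ins[OF assms(2)] using assms insert.prems by (simp add: left_deriv_pair_mult)
  also have "\<dots> = coeff (b k) {x} *\<^sub>R (a k * c * ?P b K) + (a k * b k) * (c * left_deriv x (?P b K))"
  proof -
    have "c * (a k * ?P b K) = - (a k * c * ?P b K)" by (simp add: mult.assoc[symmetric] ca)
    moreover have "c * ((a k * b k) * D) = (a k * b k) * (c * D)" for D
      using arg_cong[OF pair_commutes_with_linear_form[OF assms(1,2,3)], of "\<lambda>y. y * D"]
      by (simp add: mult.assoc)
    ultimately show ?thesis by (simp add: distrib_left right_diff_distrib)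
  qed
  also have "a k * c * ?P b K = ?P (b(k := c)) (insert k K)"
    unfolding ins[OF upd] same by simp
  also have "(a k * b k) * (c * left_deriv x (?P b K)) =
      (\<Sum>f\<in>K. coeff (b f) {x} *\<^sub>R ?P (b(f := c)) (insert k K))"
  proof -
    have "?P (b(f := c)) (insert k K) = (a k * b k) * ?P (b(f := c)) K" if "f \<in> K" for f
      using that insert.hyps by (subst ins[OF upd]) auto
    then show ?thesis
      using insert.prems by (simp add: insert.IH sum_distrib_left del: fun_upd_apply)
  qed
  finally show ?case using insert.hyps by simp
qed

section \<open>Exponentials of sums of pairs\<close>

text \<open>
  The binomial formula, which stops after the linear term in \<open>p\<close>.
\<close>

lemma square_zero_add_power:
  fixes p X :: "'a::real_algebra_1"
  assumes "p * p = 0" "p * X = X * p"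
  shows "(p + X) ^ Suc k = X ^ Suc k + real (Suc k) *\<^sub>R (p * X ^ k)"
proof (induction k)
  case (Suc k)
  have pX: "p * X ^ j = X ^ j * p" for j
    by (induction j) (simp_all add: assms(2) mult.assoc, metis assms(2) mult.assoc)
  have pp: "p * (p * F) = 0" for F by (simp add: mult.assoc[symmetric] assms(1))
  have Xp: "X * (p * F) = p * (X * F)" for F by (simp add: mult.assoc[symmetric] assms(2))
  have "(p + X) ^ Suc (Suc k) = (p + X) * (X ^ Suc k + real (Suc k) *\<^sub>R (p * X ^ k))"
    unfolding power_Suc[of _ "Suc k"] Suc.IH ..
  also have "\<dots> = X ^ Suc (Suc k) + (p * X ^ Suc k + real (Suc k) *\<^sub>R (p * X ^ Suc k))"
    by (simp add: distrib_left distrib_right pp Xp)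
  also have "p * X ^ Suc k + real (Suc k) *\<^sub>R (p * X ^ Suc k) = real (Suc (Suc k)) *\<^sub>R (p * X ^ Suc k)"
    by (simp only: of_nat_Suc[of "Suc k"] scaleR_left_distrib scaleR_one)
  finally show ?case .
qed simp

lemma grassmann_exp_truncate:
  assumes "\<And>k. k > N \<Longrightarrow> F ^ k = 0"
  shows "grassmann_exp F = (\<Sum>k\<le>N. (1 / fact k) *\<^sub>R F ^ k)"
  unfolding grassmann_exp_def
  by (rule sum.mono_neutral_left) (use assms in \<open>auto simp: not_less[symmetric]\<close>)

text \<open>
  A sum of commuting elements of square zero is nilpotent, and each summand has the exponential
  \<open>1 + p u\<close>. The induction also carries the nilpotency, because it is what allows the
  series to be cut off at \<open>card K\<close>.
\<close>

lemma grassmann_exp_sum_square_zero: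
  assumes "finite K" and comm: "\<And>u v. p u * p v = p v * p u" and sq: "\<And>u. p u * p u = 0"
  shows "grassmann_exp (\<Sum>u\<in>K. p u) = commuting_prod (\<lambda>u. 1 + p u) K"
proof -
  have comm1: "(1 + p u) * (1 + p v) = (1 + p v) * (1 + p u)" for u v
    by (simp add: distrib_left distrib_right comm)
  have "(\<forall>k>card K. (\<Sum>u\<in>K. p u) ^ k = 0) \<and>
      (\<Sum>k\<le>card K. (1 / fact k) *\<^sub>R (\<Sum>u\<in>K. p u) ^ k) = commuting_prod (\<lambda>u. 1 + p u) K"
    using assms(1)
  proof (induction K)
    case (insert v K)
    define X where "X = (\<Sum>u\<in>K. p u)"
    define N where "N = card K"
    have pX: "p v * X = X * p v" by (simp add: X_def sum_distrib_left sum_distrib_right comm)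
    note pow = square_zero_add_power[OF sq[of v] pX]
    have nil: "X ^ k = 0" if "k > N" for k using insert.IH that by (simp add: X_def N_def)
    have 1: "(p v + X) ^ k = 0" if "k > Suc N" for k
      using that nil[of k] nil[of "k - 1"] pow[of "k - 1"] by (cases k) simp_all
    have "(\<Sum>k\<le>Suc N. (1 / fact k) *\<^sub>R (p v + X) ^ k) =
        1 + (\<Sum>k\<le>N. (1 / fact (Suc k)) *\<^sub>R (p v + X) ^ Suc k)"
      by (subst sum.atMost_Suc_shift) simp
    also have "(\<Sum>k\<le>N. (1 / fact (Suc k)) *\<^sub>R (p v + X) ^ Suc k) =
        (\<Sum>k\<le>N. (1 / fact (Suc k)) *\<^sub>R X ^ Suc k) + (\<Sum>k\<le>N. (1 / fact k) *\<^sub>R (p v * X ^ k))"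
      unfolding pow sum.distrib[symmetric]
    proof (rule sum.cong)
      fix k
      have "1 / fact (Suc k) * real (Suc k) = 1 / (fact k :: real)"
        unfolding fact_Suc by (simp del: of_nat_Suc)
      then show "(1 / fact (Suc k)) *\<^sub>R (X ^ Suc k + real (Suc k) *\<^sub>R (p v * X ^ k)) =
          (1 / fact (Suc k)) *\<^sub>R X ^ Suc k + (1 / fact k) *\<^sub>R (p v * X ^ k)"
        by (simp only: scaleR_right_distrib scaleR_scaleR)
    qed simp
    also have "1 + (\<dots>) = (\<Sum>k\<le>Suc N. (1 / fact k) *\<^sub>R X ^ k) + p v * (\<Sum>k\<le>N. (1 / fact k) *\<^sub>R X ^ k)"
      by (subst sum.atMost_Suc_shift) (simp add: sum_distrib_left)
    also have "\<dots> = (1 + p v) * (\<Sum>k\<le>N. (1 / fact k) *\<^sub>R X ^ k)"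
      by (simp add: nil[of "Suc N", simplified] distrib_right)
    finally have 2: "(\<Sum>k\<le>Suc N. (1 / fact k) *\<^sub>R (p v + X) ^ k) =
        (1 + p v) * commuting_prod (\<lambda>u. 1 + p u) K"
      using insert.IH by (simp only: X_def N_def)
    show ?case
      using 1 2 insert.hyps by (simp add: X_def N_def commuting_prod_insert[OF comm1])
  qed (simp add: power_0_left)
  then show ?thesis using grassmann_exp_truncate[of "card K"] by metis
qed

text \<open>
  The product rule for \<open>exp (\<Sum>u. a u * b u) * F\<close> in factorized form, for a derivative
  that sees only the forms \<open>b u\<close>. No sign appears in front of the derivative of \<open>F\<close> since the
  exponential is even, and the factor \<open>1 + a u * b u\<close> hit by the derivative can be restored because
  \<open>(1 + a u * b u) * a u = a u\<close>.
\<close>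

lemma left_deriv_exp_mult:
  assumes "\<And>u. a u \<in> linear_forms" "\<And>u. b u \<in> linear_forms"
    and "finite K" "\<And>u. u \<in> K \<Longrightarrow> coeff (a u) {x} = 0"
  shows "left_deriv x (commuting_prod (\<lambda>u. 1 + a u * b u) K * F) =
    commuting_prod (\<lambda>u. 1 + a u * b u) K * left_deriv x F -
    (\<Sum>u\<in>K. coeff (b u) {x} *\<^sub>R (commuting_prod (\<lambda>u. 1 + a u * b u) K * (a u * F)))"
  using assms(3,4)
proof (induction K arbitrary: F)
  case (insert k K)
  let ?R = "commuting_prod (\<lambda>u. 1 + a u * b u) K"
  have comm1: "(1 + a u * b u) * (1 + a v * b v) = (1 + a v * b v) * (1 + a u * b u)" for u v
    by (simp add: distrib_left distrib_right pairs_commute assms)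
  have Ra: "?R * c = c * ?R" if c: "c \<in> linear_forms" for c
    using insert.hyps c
    by (intro commuting_prod_commute comm1)
      (simp_all add: distrib_left distrib_right pair_commutes_with_linear_form assms)
  have aab: "a k * (a k * b k) = 0"
    by (simp add: mult.assoc[symmetric] linear_form_square assms)
  have aa: "(1 + a k * b k) * a k = a k"
    by (simp add: distrib_right pair_commutes_with_linear_form assms aab)
  have kR: "(1 + a k * b k) * (?R * (a k * F)) = a k * (?R * F)"
    by (simp add: mult.assoc[symmetric] Ra assms) (simp add: aa)
  have a_left: "a u * (?R * F) = ?R * (a u * F)" for u
    by (simp add: mult.assoc[symmetric] Ra assms)
  have "left_deriv x (commuting_prod (\<lambda>u. 1 + a u * b u) (insert k K) * F) =
      left_deriv x (?R * F + (a k * b k) * (?R * F))"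
    using insert.hyps by (simp add: commuting_prod_insert[OF comm1] distrib_right mult.assoc)
  also have "\<dots> = (1 + a k * b k) * left_deriv x (?R * F) - coeff (b k) {x} *\<^sub>R (a k * (?R * F))"
    by (simp add: left_deriv_add left_deriv_pair_mult assms insert.prems distrib_right)
  also have "\<dots> = (1 + a k * b k) * left_deriv x (?R * F) -
      coeff (b k) {x} *\<^sub>R ((1 + a k * b k) * (?R * (a k * F)))"
    unfolding kR ..
  finally show ?case
    using insert
    by (simp add: commuting_prod_insert[OF comm1] right_diff_distrib sum_distrib_left mult.assoc
        algebra_simps)
qed simp

section \<open>The Berezin integral and the determinant\<close>

lemma grassmann_integral_insert:
  assumes "finite K" "x \<notin> K"
  shows "grassmann_integral (insert x K) F =
    grassmann_integral K (left_deriv (Psi_bar x) (left_deriv (Psi x) F))"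
proof -
  interpret comp_fun_commute "\<lambda>v. left_deriv (Psi_bar v) \<circ> left_deriv (Psi v)"
    by (rule comp_fun_commute_integral)
  show ?thesis using fold_insert2[OF assms] by (simp add: grassmann_integral_def)
qed

lemma linear_grassmann_integral:
  assumes "finite K"
  shows "linear (grassmann_integral K)"
  using assms
proof (induction K)
  case empty
  have "grassmann_integral {} = (\<lambda>F. F :: 'a fermion grassmann)"
    by (simp add: grassmann_integral_def fun_eq_iff)
  then show ?case by (simp add: linear_ident)
next
  case (insert x K)
  have "grassmann_integral (insert x K) =
      grassmann_integral K \<circ> (left_deriv (Psi_bar x) \<circ> left_deriv (Psi x))"
    using insert.hyps by (simp add: fun_eq_iff grassmann_integral_insert)
  then show ?case
    by (simp only:) (intro linear_compose linear_left_deriv insert.IH)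
qed

text \<open>
  On the algebra of the sites in \<open>K\<close> the integral is a scalar, which is the coefficient at \<open>{}\<close>.
\<close>

definition berezin :: "'v::countable set \<Rightarrow> 'v fermion grassmann \<Rightarrow> real" where
  "berezin K F = coeff (grassmann_integral K F) {}"

lemma linear_berezin: "finite K \<Longrightarrow> linear (berezin K)"
  by (intro linearI) (simp_all add: berezin_def linear_add[OF linear_grassmann_integral]
      linear_scale[OF linear_grassmann_integral] plus_grassmann.rep_eq scaleR_grassmann.rep_eq)

lemma berezin_empty: "berezin {} F = coeff F {}"
  by (simp add: berezin_def grassmann_integral_def)

lemma berezin_insert:
  "finite K \<Longrightarrow> x \<notin> K \<Longrightarrow>
    berezin (insert x K) F = berezin K (left_deriv (Psi_bar x) (left_deriv (Psi x) F))"
  by (simp add: berezin_def grassmann_integral_insert)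

lemma berezin_free:
  assumes "finite K" "v \<in> K" "left_deriv (Psi v) F = 0"
  shows "berezin K F = 0"
proof -
  have "berezin (insert v (K - {v})) F = 0"
    using assms by (subst berezin_insert)
      (simp_all add: linear_0[OF linear_left_deriv] linear_0[OF linear_berezin])
  then show ?thesis using assms(2) by (simp add: insert_absorb)
qed

text \<open>
  The integral already contains every derivative once, the derivatives anticommute, and each of them
  squares to zero.
\<close>

lemma berezin_left_deriv:
  assumes "finite K" "v \<in> K"
  shows "berezin K (left_deriv (Psi_bar v) F) = 0"
proof -
  have "berezin (insert v (K - {v})) (left_deriv (Psi_bar v) F) = 0"
    using assms
    by (subst berezin_insert)
      (simp_all add: left_deriv_anticommute[of "Psi v" "Psi_bar v"] left_deriv_square
        linear_neg[OF linear_left_deriv] linear_0[OF linear_berezin])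
  then show ?thesis using assms(2) by (simp add: insert_absorb)
qed

text \<open>
  Each permutation of \<open>insert x E\<close> is \<open>transpose x b \<circ> p\<close> for exactly one \<open>b\<close> and one
  permutation \<open>p\<close> of \<open>E\<close>. If \<open>b \<noteq> x\<close>, then row \<open>x\<close> takes its entry from column \<open>b\<close>, and the
  row that \<open>p\<close> assigns to column \<open>b\<close> takes it from column \<open>x\<close>; the transposition contributes the
  sign. This form of the expansion involves only determinants over the same set \<open>E\<close>, with one
  column replaced, and is the recursion that Grassmann integrals satisfy.
\<close>

lemma det_on_insert:
  assumes "finite E" "x \<notin> E"
  shows "det_on (insert x E) M = M x x * det_on E M -
    (\<Sum>b\<in>E. M x b * det_on E (\<lambda>f g. if g = b then M f x else M f g))"
proof -
  let ?t = "\<lambda>p E. of_int (sign p) * (\<Prod>u\<in>E. M u (p u))"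
  have "det_on (insert x E) M =
      (\<Sum>b\<in>insert x E. \<Sum>p | p permutes E. ?t (transpose x b \<circ> p) (insert x E))"
    unfolding det_on_def using assms by (rule sum_over_permutations_insert)
  also have "\<dots> = (\<Sum>p | p permutes E. ?t (transpose x x \<circ> p) (insert x E)) +
      (\<Sum>b\<in>E. \<Sum>p | p permutes E. ?t (transpose x b \<circ> p) (insert x E))"
    using assms by simp
  also have "(\<Sum>p | p permutes E. ?t (transpose x x \<circ> p) (insert x E)) = M x x * det_on E M"
    unfolding det_on_def sum_distrib_left
    by (rule sum.cong) (use assms in \<open>auto simp: permutes_not_in\<close>)
  also have "(\<Sum>b\<in>E. \<Sum>p | p permutes E. ?t (transpose x b \<circ> p) (insert x E)) =
      - (\<Sum>b\<in>E. M x b * det_on E (\<lambda>f g. if g = b then M f x else M f g))"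
    unfolding det_on_def sum_distrib_left sum_negf[symmetric]
  proof (intro sum.cong refl)
    fix b p assume b: "b \<in> E" and "p \<in> {p. p permutes E}"
    then have p: "p permutes E" by simp
    have "sign (transpose x b \<circ> p) = - sign p"
      using b p assms by (subst sign_compose)
        (auto simp: sign_swap_id permutation_swap_id intro: permutes_imp_permutation)
    moreover have "(transpose x b \<circ> p) x = b"
      using p assms(2) by (simp add: permutes_not_in)
    moreover have "M u ((transpose x b \<circ> p) u) = (if p u = b then M u x else M u (p u))"
      if "u \<in> E" for u
      using that p assms(2) permutes_in_image[OF p, of u] by (auto simp: transpose_def)
    ultimately show "?t (transpose x b \<circ> p) (insert x E) =
        - (M x b * (of_int (sign p) * (\<Prod>u\<in>E. if p u = b then M u x else M u (p u))))"
      using assms by simp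
  qed
  finally show ?thesis by simp
qed

text \<open>
  By \<open>grassmann_exp_sum_square_zero\<close> this is the exponential of the sum over \<open>u\<close> of
  \<open>Psi u * b u\<close>.
\<close>

abbreviation psi_exp :: "('v::countable \<Rightarrow> 'v fermion grassmann) \<Rightarrow> 'v set \<Rightarrow> 'v fermion grassmann" where
  "psi_exp b \<equiv> commuting_prod (\<lambda>u. 1 + generator (Psi u) * b u)"

lemma one_plus_pairs_commute:
  assumes "\<And>u. a u \<in> linear_forms" "\<And>u. b u \<in> linear_forms"
  shows "(1 + a u * b u) * (1 + a v * b v) = (1 + a v * b v) * (1 + a u * b u)"
  by (simp add: distrib_left distrib_right pairs_commute assms)

text \<open>
  Integrating out the two fermions at \<open>x\<close> gives the coefficient of the fermion \<open>Psi_bar x\<close> in \<open>b x\<close>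
  times the integral over the other sites, minus terms in which \<open>b x\<close> takes the place of one of the
  remaining \<open>b u\<close>. This is the recursion of \<open>det_on_insert\<close>.
\<close>

lemma berezin_psi_exp:
  assumes "finite K" "\<And>u. b u \<in> linear_forms" "\<And>u v. coeff (b u) {Psi v} = 0"
  shows "berezin K (psi_exp b K) = det_on K (\<lambda>f g. coeff (b g) {Psi_bar f})"
  using assms
proof (induction K arbitrary: b)
  case empty
  show ?case by (simp add: berezin_empty one_grassmann.rep_eq det_on_def)
next
  case (insert x K)
  let ?a = "\<lambda>u. generator (Psi u) :: 'a fermion grassmann"
  note b = insert.prems
  have R_insert: "psi_exp b' (insert u J) = (1 + ?a u * b' u) * psi_exp b' J"
    if "finite J" "u \<notin> J" "\<And>u. b' u \<in> linear_forms" for b' u J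
    using that by (intro commuting_prod_insert one_plus_pairs_commute) auto
  have comm: "psi_exp b J * c = c * psi_exp b J" if "finite J" "c \<in> linear_forms" for c J
    using that b by (intro commuting_prod_commute one_plus_pairs_commute)
      (simp_all add: distrib_left distrib_right pair_commutes_with_linear_form)
  have free: "left_deriv (Psi u) (psi_exp b J) = 0" if "finite J" "u \<notin> J" for u J
  proof -
    have "left_deriv (Psi u) (psi_exp b J * 1) = psi_exp b J * left_deriv (Psi u) 1 -
        (\<Sum>v\<in>J. coeff (b v) {Psi u} *\<^sub>R (psi_exp b J * (?a v * 1)))"
      by (rule left_deriv_exp_mult) (use that b in \<open>auto simp: generator.rep_eq\<close>)
    then show ?thesis by (simp add: b left_deriv_one)
  qed
  have "left_deriv (Psi x) (psi_exp b (insert x K)) = b x * psi_exp b K"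
    using insert.hyps b
    by (simp add: R_insert distrib_right left_deriv_add free mult.assoc left_deriv_generator_mult
        left_deriv_linear_form_mult)
  moreover have "left_deriv (Psi_bar x) (b x * psi_exp b K) = coeff (b x) {Psi_bar x} *\<^sub>R psi_exp b K -
      (\<Sum>u\<in>K. coeff (b u) {Psi_bar x} *\<^sub>R (?a u * b x * psi_exp b K))"
  proof -
    have "left_deriv (Psi_bar x) (psi_exp b K) =
        - (\<Sum>u\<in>K. coeff (b u) {Psi_bar x} *\<^sub>R (?a u * psi_exp b K))"
      using left_deriv_exp_mult[of ?a b K "Psi_bar x" 1] insert.hyps b
      by (auto simp: generator.rep_eq left_deriv_one comm)
    moreover have "b x * ?a u = - (?a u * b x)" for u
      by (rule linear_forms_anticommute) (use b in simp_all)
    ultimately show ?thesis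
      using b by (simp add: left_deriv_linear_form_mult sum_distrib_left mult.assoc[symmetric] sum_negf)
  qed
  ultimately have expand: "berezin (insert x K) (psi_exp b (insert x K)) =
      coeff (b x) {Psi_bar x} * berezin K (psi_exp b K) -
      (\<Sum>u\<in>K. coeff (b u) {Psi_bar x} * berezin K (?a u * b x * psi_exp b K))"
    using insert.hyps by (simp add: berezin_insert linear_diff[OF linear_berezin]
        linear_sum[OF linear_berezin] linear_scale[OF linear_berezin])
  have "berezin K (?a u * b x * psi_exp b K) = berezin K (psi_exp (b(u := b x)) K)"
    if u: "u \<in> K" for u
  proof -
    define J where "J = K - {u}"
    have J: "K = insert u J" "u \<notin> J" "finite J" using u insert.hyps by (auto simp: J_def)
    have upd: "(b(u := b x)) v \<in> linear_forms" for v using b by simp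
    \<comment> \<open>The two integrands differ by a term without the fermion \<open>Psi u\<close>, which the integral kills.\<close>
    have "psi_exp (b(u := b x)) J = psi_exp b J"
      using J b by (intro commuting_prod_cong one_plus_pairs_commute) auto
    then have "psi_exp (b(u := b x)) K = psi_exp b J + ?a u * b x * psi_exp b J"
      using J b upd by (simp add: R_insert distrib_right)
    moreover have "?a u * b x * psi_exp b K = ?a u * b x * psi_exp b J"
    proof -
      have "(?a u * b x) * (?a u * b u) = - (?a u * ?a u * (b x * b u))"
        using linear_forms_anticommute[of "b x" "?a u"] b
        by (simp add: mult.assoc) (simp add: mult.assoc[symmetric])
      also have "\<dots> = 0" by (simp add: linear_form_square)
      finally show ?thesis
        using J b by (simp add: R_insert distrib_right distrib_left mult.assoc[symmetric])
    qed
    moreover have "berezin K (psi_exp b J) = 0"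
      using J insert.hyps u by (intro berezin_free[of K u] free)
    ultimately show ?thesis using insert.hyps by (simp add: linear_add[OF linear_berezin])
  qed
  moreover have "berezin K (psi_exp (b(u := b x)) K) =
      det_on K (\<lambda>f g. if g = u then coeff (b x) {Psi_bar f} else coeff (b g) {Psi_bar f})" for u
    using b by (subst insert.IH) (auto simp: fun_eq_iff intro!: arg_cong[of _ _ "det_on K"])
  ultimately show ?case
    using insert.hyps b by (simp add: expand det_on_insert insert.IH)
qed

section \<open>Wick's theorem\<close>

lemma left_deriv_pair_prod_free:
  assumes "\<And>f. a f \<in> linear_forms" "\<And>f. b f \<in> linear_forms" "finite K"
    and "\<And>f. f \<in> K \<Longrightarrow> coeff (a f) {x} = 0" "\<And>f. f \<in> K \<Longrightarrow> coeff (b f) {x} = 0"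
  shows "left_deriv x (commuting_prod (\<lambda>f. a f * b f) K) = 0"
  using assms(3-5)
  by (induction K) (simp_all add: left_deriv_one commuting_prod_pairs_insert left_deriv_pair_mult assms(1,2))

text \<open>
  The value of the integral on the monomial of top degree shows that it is not identically zero.
\<close>

lemma berezin_top_monomial:
  assumes "finite K"
  shows "berezin K (commuting_prod (\<lambda>u. generator (Psi u) * generator (Psi_bar u)) K) = 1"
  using assms
proof (induction K)
  case empty
  show ?case by (simp add: berezin_empty one_grassmann.rep_eq)
next
  case (insert x K)
  let ?P = "commuting_prod (\<lambda>u. generator (Psi u) * generator (Psi_bar u)) K"
  have free: "left_deriv (Psi x) ?P = 0" "left_deriv (Psi_bar x) ?P = 0"
    using insert.hyps by (intro left_deriv_pair_prod_free; auto simp: generator.rep_eq)+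
  have "left_deriv (Psi_bar x) (left_deriv (Psi x)
      (commuting_prod (\<lambda>u. generator (Psi u) * generator (Psi_bar u)) (insert x K))) = ?P"
    using insert.hyps
    by (simp add: commuting_prod_pairs_insert mult.assoc left_deriv_generator_mult free)
  then show ?case using insert by (simp add: berezin_insert)
qed

text \<open>
  The bilinear extension of the two-point function, in which \<open>Psi w\<close> paired with \<open>Psi_bar v\<close>
  gives \<open>G v w\<close>.
\<close>

definition contraction ::
    "'v::countable set \<Rightarrow> ('v \<Rightarrow> 'v \<Rightarrow> real) \<Rightarrow> 'v fermion grassmann \<Rightarrow> 'v fermion grassmann \<Rightarrow> real" where
  "contraction L G a b = (\<Sum>w\<in>L. \<Sum>v\<in>L. coeff a {Psi w} * G v w * coeff b {Psi_bar v})"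

text \<open>
  In terms of these forms the action is \<open>\<Sum>u\<in>L. Psi u * dual_row L A u\<close>, a sum of commuting pairs.
\<close>

definition dual_row :: "'v::countable set \<Rightarrow> ('v \<Rightarrow> 'v \<Rightarrow> real) \<Rightarrow> 'v \<Rightarrow> 'v fermion grassmann" where
  "dual_row L A u = (\<Sum>v\<in>L. A u v *\<^sub>R generator (Psi_bar v))"

lemma coeff_sum: "coeff (\<Sum>i\<in>I. F i) S = (\<Sum>i\<in>I. coeff (F i) S)"
  by (induction I rule: infinite_finite_induct) (simp_all add: zero_grassmann.rep_eq plus_grassmann.rep_eq)

lemma dual_row_linear_form: "dual_row L A u \<in> linear_forms"
  unfolding dual_row_def by (intro linear_forms_combine generator_linear_form)

lemma coeff_dual_row:
  assumes "finite L"
  shows "coeff (dual_row L A u) {Psi v} = 0"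
    and "coeff (dual_row L A u) {Psi_bar v} = (if v \<in> L then A u v else 0)"
  using assms by (simp_all add: dual_row_def coeff_sum scaleR_grassmann.rep_eq generator.rep_eq
      if_distrib[of "\<lambda>r. _ * r"] cong: if_cong)

text \<open>
  Grassmann Gaussian integrals with action \<open>A\<close> and covariance \<open>G\<close>.
\<close>

locale fermionic_gaussian =
  fixes L :: "'v::countable set" and A G :: "'v \<Rightarrow> 'v \<Rightarrow> real"
  assumes finite_sites: "finite L"
    and inverse: "\<And>u w. u \<in> L \<Longrightarrow> w \<in> L \<Longrightarrow> (\<Sum>v\<in>L. A u v * G v w) = of_bool (u = w)"
begin

definition gauss :: "'v fermion grassmann" where
  "gauss = psi_exp (dual_row L A) L"

lemma grassmann_exp_action:
  "grassmann_exp (\<Sum>u\<in>L. \<Sum>v\<in>L. A u v *\<^sub>R (generator (Psi u) * generator (Psi_bar v))) = gauss"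
proof -
  have "(\<Sum>v\<in>L. A u v *\<^sub>R (generator (Psi u) * generator (Psi_bar v))) =
      generator (Psi u) * dual_row L A u" for u
    by (simp add: dual_row_def sum_distrib_left)
  then have "grassmann_exp (\<Sum>u\<in>L. \<Sum>v\<in>L. A u v *\<^sub>R (generator (Psi u) * generator (Psi_bar v))) =
      grassmann_exp (\<Sum>u\<in>L. generator (Psi u) * dual_row L A u)" by simp
  also have "\<dots> = gauss"
    unfolding gauss_def
  proof (rule grassmann_exp_sum_square_zero[OF finite_sites])
    fix u
    have "(generator (Psi u) * dual_row L A u) * (generator (Psi u) * dual_row L A u) =
        generator (Psi u) * (generator (Psi u) * dual_row L A u) * dual_row L A u"
      using pair_commutes_with_linear_form[of "generator (Psi u)" "dual_row L A u" "generator (Psi u)"]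
      by (simp add: dual_row_linear_form mult.assoc[symmetric])
    also have "\<dots> = 0"
      by (simp add: mult.assoc[symmetric] linear_form_square)
    finally show "(generator (Psi u) * dual_row L A u) * (generator (Psi u) * dual_row L A u) = 0" .
  qed (simp add: pairs_commute dual_row_linear_form)
  finally show ?thesis .
qed

definition gauss_integral :: "'v fermion grassmann \<Rightarrow> real" where
  "gauss_integral F = berezin L (gauss * F)"

lemma linear_gauss_integral: "linear gauss_integral"
  unfolding gauss_integral_def
  by (intro linearI) (simp_all add: distrib_left linear_add[OF linear_berezin]
      linear_scale[OF linear_berezin] finite_sites)

lemma gauss_integral_one: "gauss_integral 1 = det_on L (\<lambda>f g. A g f)"
proof -
  have "gauss_integral 1 = det_on L (\<lambda>f g. coeff (dual_row L A g) {Psi_bar f})"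
    unfolding gauss_integral_def gauss_def
    by (simp add: berezin_psi_exp finite_sites dual_row_linear_form coeff_dual_row)
  also have "\<dots> = det_on L (\<lambda>f g. A g f)"
    unfolding det_on_def by (intro sum.cong arg_cong2[of _ _ _ _ "(*)"] prod.cong refl)
      (simp_all add: coeff_dual_row finite_sites)
  finally show ?thesis .
qed

text \<open>
  The integral of the derivative of \<open>gauss * F\<close> vanishes; the product rule gives the two sides.
\<close>

lemma integration_by_parts:
  assumes "v \<in> L"
  shows "gauss_integral (left_deriv (Psi_bar v) F) = (\<Sum>u\<in>L. A u v * gauss_integral (generator (Psi u) * F))"
proof -
  have "left_deriv (Psi_bar v) (gauss * F) = gauss * left_deriv (Psi_bar v) F -
      (\<Sum>u\<in>L. coeff (dual_row L A u) {Psi_bar v} *\<^sub>R (gauss * (generator (Psi u) * F)))"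
    unfolding gauss_def
    by (rule left_deriv_exp_mult) (simp_all add: dual_row_linear_form finite_sites generator.rep_eq)
  moreover have "berezin L (left_deriv (Psi_bar v) (gauss * F)) = 0"
    using finite_sites assms by (rule berezin_left_deriv)
  ultimately show ?thesis
    using assms unfolding gauss_integral_def
    by (simp add: linear_diff[OF linear_berezin] linear_sum[OF linear_berezin]
        linear_scale[OF linear_berezin] finite_sites coeff_dual_row)
qed

text \<open>
  Integration by parts is a linear system with matrix \<open>A\<close> for the integrals of \<open>Psi u * F\<close>. Applying
  \<open>G\<close> solves it.
\<close>

lemma gauss_integral_psi_mult:
  assumes "w \<in> L"
  shows "gauss_integral (generator (Psi w) * F) =
    (\<Sum>v\<in>L. G v w * gauss_integral (left_deriv (Psi_bar v) F))"
proof -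
  have "(\<Sum>v\<in>L. G v w * gauss_integral (left_deriv (Psi_bar v) F)) =
      (\<Sum>v\<in>L. \<Sum>u\<in>L. (A u v * G v w) * gauss_integral (generator (Psi u) * F))"
    by (simp add: integration_by_parts sum_distrib_left mult_ac)
  also have "\<dots> = (\<Sum>u\<in>L. (\<Sum>v\<in>L. A u v * G v w) * gauss_integral (generator (Psi u) * F))"
    by (subst sum.swap) (simp add: sum_distrib_right)
  also have "\<dots> = (\<Sum>u\<in>L. of_bool (u = w) * gauss_integral (generator (Psi u) * F))"
    by (rule sum.cong) (simp_all add: inverse assms)
  also have "\<dots> = gauss_integral (generator (Psi w) * F)"
    using assms finite_sites by simp
  finally show ?thesis by simp
qed

lemma psi_form:
  assumes "a \<in> span ((\<lambda>w. generator (Psi w)) ` L)"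
  shows "a \<in> linear_forms" "coeff a {Psi_bar v} = 0"
    "gauss_integral (a * F) = (\<Sum>w\<in>L. coeff a {Psi w} * gauss_integral (generator (Psi w) * F))"
proof -
  show "a \<in> linear_forms"
    using assms span_mono[of "(\<lambda>w. generator (Psi w)) ` L" "range generator"]
    by (auto simp: linear_forms_def)
  show "coeff a {Psi_bar v} = 0"
    using assms
    by (induction a rule: span_induct_alt)
      (auto simp: zero_grassmann.rep_eq plus_grassmann.rep_eq scaleR_grassmann.rep_eq generator.rep_eq)
  show "gauss_integral (a * F) = (\<Sum>w\<in>L. coeff a {Psi w} * gauss_integral (generator (Psi w) * F))"
    using assms
  proof (induction a rule: span_induct_alt)
    case base
    show ?case by (simp add: zero_grassmann.rep_eq linear_0[OF linear_gauss_integral])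
  next
    case (step c y z)
    then obtain u where u: "y = generator (Psi u)" "u \<in> L" by blast
    have "(\<Sum>w\<in>L. (c * (if w = u then 1 else 0)) * gauss_integral (generator (Psi w) * F)) =
        (\<Sum>w\<in>L. if w = u then c * gauss_integral (generator (Psi u) * F) else 0)"
      by (rule sum.cong) auto
    then show ?case
      using finite_sites u
      by (simp add: step.IH distrib_right linear_add[OF linear_gauss_integral]
          linear_scale[OF linear_gauss_integral] plus_grassmann.rep_eq scaleR_grassmann.rep_eq
          generator.rep_eq sum.distrib)
  qed
qed

text \<open>
  Replace \<open>a x\<close> by derivatives through integration by parts. The derivative either hits \<open>b x\<close>, which
  gives the contraction of \<open>a x\<close> and \<open>b x\<close>, or it hits some other \<open>b f\<close>, and then \<open>b x\<close> moves into
  the place of \<open>b f\<close>. The result is again the recursion of \<open>det_on_insert\<close>. The induction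
  is over \<open>E\<close> for all families \<open>b\<close> at once, since the family changes.
\<close>

theorem wick:
  assumes "finite E" "\<And>f. a f \<in> linear_forms" "\<And>f. b f \<in> linear_forms"
    and "\<And>f. f \<in> E \<Longrightarrow> a f \<in> span ((\<lambda>w. generator (Psi w)) ` L)"
  shows "gauss_integral (commuting_prod (\<lambda>f. a f * b f) E) =
    gauss_integral 1 * det_on E (\<lambda>f g. contraction L G (a f) (b g))"
  using assms(1,3,4)
proof (induction E arbitrary: b)
  case empty
  show ?case by (simp add: det_on_def)
next
  case (insert x E)
  let ?P = "\<lambda>b. commuting_prod (\<lambda>f. a f * b f) E"
  have upd: "(b(f := b x)) g \<in> linear_forms" for f g using insert.prems by simp
  have deriv: "left_deriv (Psi_bar v) (b x * ?P b) = coeff (b x) {Psi_bar v} *\<^sub>R ?P b -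
      (\<Sum>f\<in>E. coeff (b f) {Psi_bar v} *\<^sub>R ?P (b(f := b x)))" for v
    using insert.hyps insert.prems psi_form(2)
    by (simp add: left_deriv_linear_form_mult left_deriv_pair_prod assms(2) del: fun_upd_apply)
  have replaced: "gauss_integral (?P (b(h := b x))) = gauss_integral 1 *
      det_on E (\<lambda>f g. if g = h then contraction L G (a f) (b x) else contraction L G (a f) (b g))" for h
  proof -
    have "gauss_integral (?P (b(h := b x))) =
        gauss_integral 1 * det_on E (\<lambda>f g. contraction L G (a f) ((b(h := b x)) g))"
      using insert.prems upd by (intro insert.IH) auto
    also have "(\<lambda>f g. contraction L G (a f) ((b(h := b x)) g)) =
        (\<lambda>f g. if g = h then contraction L G (a f) (b x) else contraction L G (a f) (b g))"
      by (auto simp: fun_eq_iff)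
    finally show ?thesis .
  qed
  have "gauss_integral (commuting_prod (\<lambda>f. a f * b f) (insert x E)) = gauss_integral (a x * (b x * ?P b))"
    using insert.hyps insert.prems by (simp add: commuting_prod_pairs_insert assms(2) mult.assoc)
  also have "\<dots> = (\<Sum>w\<in>L. \<Sum>v\<in>L. coeff (a x) {Psi w} * G v w *
      gauss_integral (left_deriv (Psi_bar v) (b x * ?P b)))"
    using insert.prems by (simp add: psi_form(3) gauss_integral_psi_mult sum_distrib_left mult.assoc)
  also have "\<dots> = (\<Sum>w\<in>L. \<Sum>v\<in>L. coeff (a x) {Psi w} * G v w * (coeff (b x) {Psi_bar v} * gauss_integral (?P b) -
      (\<Sum>f\<in>E. coeff (b f) {Psi_bar v} * gauss_integral (?P (b(f := b x))))))"
    unfolding deriv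
    by (simp only: linear_diff[OF linear_gauss_integral] linear_sum[OF linear_gauss_integral]
        linear_scale[OF linear_gauss_integral] real_scaleR_def)
  also have "\<dots> = contraction L G (a x) (b x) * gauss_integral (?P b) -
      (\<Sum>f\<in>E. contraction L G (a x) (b f) * gauss_integral (?P (b(f := b x))))"
  proof -
    have swap: "(\<Sum>w\<in>L. \<Sum>v\<in>L. \<Sum>f\<in>E. h w v f) = (\<Sum>f\<in>E. \<Sum>w\<in>L. \<Sum>v\<in>L. h w v f)"
      for h :: "'v \<Rightarrow> 'v \<Rightarrow> 'a \<Rightarrow> real"
      by (subst sum.swap[of _ E]) (simp add: sum.swap[of _ E])
    show ?thesis
      by (simp add: contraction_def right_diff_distrib sum_subtractf sum_distrib_left sum_distrib_right
          mult.assoc del: fun_upd_apply) (rule swap)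
  qed
  also have "gauss_integral (?P b) = gauss_integral 1 * det_on E (\<lambda>f g. contraction L G (a f) (b g))"
    using insert.prems by (intro insert.IH) auto
  finally show ?case
    using insert.hyps
    by (simp add: replaced det_on_insert right_diff_distrib sum_distrib_left mult_ac del: fun_upd_apply)
qed

text \<open>
  If the total integral were zero, Wick's theorem would make the integral of the monomial of top degree
  zero as well. But multiplying this monomial by the exponential does not change it, and its integral is
  one.
\<close>

lemma gauss_integral_one_nonzero: "gauss_integral 1 \<noteq> 0"
proof
  assume zero: "gauss_integral 1 = 0"
  let ?a = "\<lambda>u. generator (Psi u) :: 'v fermion grassmann"
  let ?b = "\<lambda>u. generator (Psi_bar u) :: 'v fermion grassmann"
  let ?P = "commuting_prod (\<lambda>u. ?a u * ?b u)"
  have "gauss_integral (?P L) = 0"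
    using finite_sites zero by (subst wick) (auto intro: span_base)
  moreover have "psi_exp (dual_row L A) K * ?P L = ?P L" if "K \<subseteq> L" for K
  proof -
    have "finite K" using that finite_sites finite_subset by blast
    then show ?thesis using that
    proof (induction K)
      case (insert k K)
      have "?P (insert k (L - {k})) = (?a k * ?b k) * ?P (L - {k})"
        using finite_sites by (intro commuting_prod_pairs_insert) auto
      then have P: "?P L = ?a k * (?b k * ?P (L - {k}))"
        using insert.prems by (simp add: insert_absorb mult.assoc)
      have "?a k * (dual_row L A k * ?a k) = ?a k * (- (?a k * dual_row L A k))"
        by (subst linear_forms_anticommute) (simp_all add: dual_row_linear_form)
      also have "\<dots> = - (?a k * ?a k * dual_row L A k)"
        by (simp add: mult.assoc)
      finally have "?a k * dual_row L A k * ?a k = 0"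
        by (simp add: linear_form_square mult.assoc)
      then have "(?a k * dual_row L A k) * ?P L = 0"
        unfolding P by (simp add: mult.assoc[symmetric])
      moreover have "psi_exp (dual_row L A) (insert k K) =
          (1 + ?a k * dual_row L A k) * psi_exp (dual_row L A) K"
        using insert.hyps
        by (intro commuting_prod_insert one_plus_pairs_commute) (auto simp: dual_row_linear_form)
      ultimately show ?case using insert by (simp add: mult.assoc distrib_right)
    qed simp
  qed
  ultimately show False
    using berezin_top_monomial[OF finite_sites] by (simp add: gauss_integral_def gauss_def)
qed

end

section \<open>The Dirichlet Green function\<close>

lemma unit_vectors_uminus: "- e \<in> unit_vectors \<longleftrightarrow> e \<in> unit_vectors"
proof -
  have "- f \<in> unit_vectors" if "f \<in> unit_vectors" for f :: "int ^ 'a"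
    using that by (auto simp: unit_vectors_def)
  from this[of e] this[of "- e"] show ?thesis by auto
qed

lemma nearest_neighbours_sym: "nearest_neighbours u v \<longleftrightarrow> nearest_neighbours v u"
  using unit_vectors_uminus[of "v - u"] by (simp add: nearest_neighbours_def)

lemma laplacian_sym: "laplacian u v = laplacian v u"
  by (simp add: laplacian_def nearest_neighbours_sym)

lemma card_unit_vectors_le: "card (unit_vectors :: (int ^ 'd) set) \<le> 2 * CARD('d)"
proof -
  have "card (unit_vectors :: (int ^ 'd) set) \<le>
      card (range (\<lambda>i. axis i 1 :: int ^ 'd)) + card (range (\<lambda>i. - axis i 1 :: int ^ 'd))"
    unfolding unit_vectors_def by (rule card_Un_le)
  also have "\<dots> \<le> CARD('d) + CARD('d)" by (intro add_mono card_image_le) simp_all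
  finally show ?thesis by simp
qed

lemma zero_not_unit_vector: "(0 :: int ^ 'd) \<notin> unit_vectors"
proof -
  have "axis i 1 \<noteq> (0 :: int ^ 'd)" for i
    by (auto simp: vec_eq_iff axis_def)
  then show ?thesis by (auto simp: unit_vectors_def)
qed

text \<open>
  The Dirichlet Laplacian as the sum over all neighbours of the extension of \<open>f\<close> by zero.
\<close>

lemma sum_laplacian:
  fixes f :: "int ^ 'd \<Rightarrow> real"
  assumes "finite L" "u \<in> L"
  shows "(\<Sum>v\<in>L. laplacian u v * f v) =
    (\<Sum>e\<in>unit_vectors. if u + e \<in> L then f (u + e) else 0) - 2 * real CARD('d) * f u"
proof -
  have "(\<Sum>v\<in>L. laplacian u v * f v) =
      laplacian u u * f u + (\<Sum>v\<in>L - {u}. laplacian u v * f v)"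
    using assms by (simp add: sum.remove)
  also have "(\<Sum>v\<in>L - {u}. laplacian u v * f v) = (\<Sum>v\<in>{v \<in> L. v - u \<in> unit_vectors}. f v)"
    using assms zero_not_unit_vector
    by (intro sum.mono_neutral_cong_right)
      (auto simp: laplacian_def nearest_neighbours_def)
  also have "\<dots> = (\<Sum>e\<in>{e \<in> unit_vectors. u + e \<in> L}. f (u + e))"
    by (rule sum.reindex_bij_witness[of _ "\<lambda>e. u + e" "\<lambda>v. v - u"]) auto
  also have "\<dots> = (\<Sum>e\<in>unit_vectors. if u + e \<in> L then f (u + e) else 0)"
    by (rule sum.inter_filter) (rule finite_unit_vectors)
  finally show ?thesis by (simp add: laplacian_def)
qed

text \<open>
  The maximum principle. At a site where \<open>f\<close> has a positive maximum, the sum over the at most \<open>2d\<close>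
  neighbours can reach \<open>2d\<close> times the maximum only if each neighbour lies in \<open>L\<close> and is a maximum as
  well. A maximum that is extremal in a coordinate direction has a neighbour for which this fails.
\<close>

lemma harmonic_nonpos:
  fixes f :: "int ^ 'd \<Rightarrow> real"
  assumes "finite L" and harmonic: "\<And>u. u \<in> L \<Longrightarrow> (\<Sum>v\<in>L. laplacian u v * f v) = 0"
    and "x \<in> L"
  shows "f x \<le> 0"
proof (rule ccontr)
  assume "\<not> f x \<le> 0"
  define m where "m = Max (f ` L)"
  have f_le: "f u \<le> m" if "u \<in> L" for u using that assms(1) by (simp add: m_def)
  have m_pos: "m > 0" using f_le[OF assms(3)] \<open>\<not> f x \<le> 0\<close> by simp
  obtain i :: 'd where True by simp
  let ?U = "{u \<in> L. f u = m}"
  have "m \<in> f ` L" unfolding m_def using assms(1,3) by (intro Max_in) auto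
  then have "?U \<noteq> {}" "finite ?U" using assms(1) by auto
  then have "Max ((\<lambda>u. u $ i) ` ?U) \<in> (\<lambda>u. u $ i) ` ?U" by (intro Max_in) auto
  then obtain u where u: "u \<in> L" "f u = m" and "u $ i = Max ((\<lambda>u. u $ i) ` ?U)" by auto
  then have extremal: "w $ i \<le> u $ i" if "w \<in> L" "f w = m" for w
    using that \<open>finite ?U\<close> by simp
  let ?g = "\<lambda>e. if u + e \<in> L then f (u + e) else 0"
  have dir: "axis i 1 \<in> (unit_vectors :: (int ^ 'd) set)" by (auto simp: unit_vectors_def)
  have small: "?g (axis i 1) < m"
    using extremal[of "u + axis i 1"] f_le[of "u + axis i 1"] m_pos by (auto simp: less_le)
  have "(\<Sum>e\<in>unit_vectors. ?g e) < (\<Sum>e\<in>(unit_vectors :: (int ^ 'd) set). m)"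
  proof (rule sum_strict_mono_ex1[OF finite_unit_vectors])
    show "\<forall>e\<in>unit_vectors. ?g e \<le> m" using f_le m_pos by (simp add: less_imp_le)
    show "\<exists>e\<in>unit_vectors. ?g e < m" using small dir by (rule bexI)
  qed
  also have "\<dots> = real (card (unit_vectors :: (int ^ 'd) set)) * m" by simp
  also have "\<dots> \<le> real (2 * CARD('d)) * m"
    using m_pos card_unit_vectors_le[where 'd = 'd]
    by (intro mult_right_mono) (simp_all only: of_nat_le_iff less_imp_le)
  finally show False
    using harmonic[OF u(1)] u by (simp add: sum_laplacian assms(1))
qed

lemma dirichlet_laplacian_injective:
  assumes "finite L" "\<And>u. u \<in> L \<Longrightarrow> (\<Sum>v\<in>L. laplacian u v * f v) = 0" "x \<in> L"
  shows "f x = 0"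
proof -
  have "f x \<le> 0" using assms by (rule harmonic_nonpos)
  moreover have "- f x \<le> 0"
    using assms by (intro harmonic_nonpos[of L "\<lambda>v. - f v"]) (simp_all add: sum_negf)
  ultimately show ?thesis by simp
qed

text \<open>
  The generators of a Grassmann algebra serve as a basis of a space of dimension \<open>card L\<close>. The columns
  \<open>T v\<close> of \<open>A\<close> are independent by injectivity, and by their number they span this space.
  The coefficients of the basis vectors with respect to them form the inverse.
\<close>

lemma injective_matrix_right_inverse:
  fixes A :: "'v::countable \<Rightarrow> 'v \<Rightarrow> real"
  assumes fin: "finite L"
    and inj: "\<And>f v. (\<And>u. u \<in> L \<Longrightarrow> (\<Sum>v\<in>L. A u v * f v) = 0) \<Longrightarrow> v \<in> L \<Longrightarrow> f v = 0"
  obtains G where "\<And>u w. u \<in> L \<Longrightarrow> w \<in> L \<Longrightarrow> (\<Sum>v\<in>L. A u v * G v w) = of_bool (u = w)"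
proof -
  define T where "T v = (\<Sum>u\<in>L. A u v *\<^sub>R generator u)" for v
  have coeff_T: "coeff (\<Sum>v\<in>L. f v *\<^sub>R T v) {u} = (\<Sum>v\<in>L. A u v * f v)" if "u \<in> L" for f u
    using that fin by (simp add: coeff_sum T_def scaleR_grassmann.rep_eq generator.rep_eq
        if_distrib[of "\<lambda>r. _ * r"] mult_ac cong: if_cong)
  have T_indep: "f v = 0" if "(\<Sum>v\<in>L. f v *\<^sub>R T v) = 0" "v \<in> L" for f v
    using that(2) by (rule inj[rotated]) (use that(1) in \<open>simp add: coeff_T[symmetric] zero_grassmann.rep_eq\<close>)
  have inj_T: "inj_on T L"
  proof (rule inj_onI, rule ccontr)
    fix v w assume vw: "v \<in> L" "w \<in> L" "T v = T w" "v \<noteq> w"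
    have "(\<Sum>x\<in>L. (if x = v then 1 else if x = w then - 1 else (0::real)) *\<^sub>R T x) =
        (\<Sum>x\<in>{v, w}. (if x = v then 1 else if x = w then - 1 else (0::real)) *\<^sub>R T x)"
      using fin vw by (intro sum.mono_neutral_right) auto
    also have "\<dots> = 0" using vw by simp
    finally have "(if v = v then 1 else if v = w then - 1 else (0::real)) = 0"
      using vw(1) by (rule T_indep)
    then show False by simp
  qed
  have inj_gen: "inj_on (generator :: 'v \<Rightarrow> 'v grassmann) L"
  proof (rule inj_onI)
    fix v w :: 'v assume "generator v = generator w"
    then have "coeff (generator v) {v} = coeff (generator w) {v}" by simp
    then show "v = w" by (simp add: generator.rep_eq split: if_splits)
  qed
  have indep: "independent (T ` L)"
  proof
    assume "dependent (T ` L)"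
    then obtain c v where "v \<in> L" "c (T v) \<noteq> 0" "(\<Sum>x\<in>T ` L. c x *\<^sub>R x) = 0"
      using fin by (auto simp: dependent_finite)
    then show False using T_indep[of "\<lambda>v. c (T v)" v] inj_T by (simp add: sum.reindex)
  qed
  have gen_span: "generator w \<in> span (T ` L)" if w: "w \<in> L" for w
  proof (rule ccontr)
    assume not_in: "generator w \<notin> span (T ` L)"
    have "T v \<in> span (generator ` L)" for v
      unfolding T_def by (intro span_sum span_scale span_base) auto
    then have "insert (generator w) (T ` L) \<subseteq> span (generator ` L)"
      using w by (auto intro: span_base)
    then have "card (insert (generator w) (T ` L)) \<le> card (generator ` L)"
      using fin
      by (intro conjunct2[OF independent_span_bound[OF _ independent_insertI[OF not_in indep]]]) simp_all
    moreover have "generator w \<notin> T ` L" using not_in span_base by blast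
    ultimately show False using fin inj_T inj_gen by (simp add: card_image)
  qed
  have c_ex: "\<exists>c. generator w = (\<Sum>v\<in>L. c (T v) *\<^sub>R T v)" if w: "w \<in> L" for w
  proof -
    have "span (T ` L) = range (\<lambda>c. \<Sum>x\<in>T ` L. c x *\<^sub>R x)" using fin by (intro span_finite) simp
    then obtain c where "generator w = (\<Sum>x\<in>T ` L. c x *\<^sub>R x)" using gen_span[OF w] by auto
    also have "\<dots> = (\<Sum>v\<in>L. c (T v) *\<^sub>R T v)" using inj_T by (simp add: sum.reindex)
    finally show ?thesis by (rule exI[of _ c])
  qed
  define c where "c w = (SOME c. generator w = (\<Sum>v\<in>L. c (T v) *\<^sub>R T v))" for w
  have c: "generator w = (\<Sum>v\<in>L. c w (T v) *\<^sub>R T v)" if "w \<in> L" for w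
    unfolding c_def by (rule someI_ex[OF c_ex[OF that]])
  show ?thesis
  proof
    fix u w assume uw: "u \<in> L" "w \<in> L"
    have "(\<Sum>v\<in>L. A u v * c w (T v)) = coeff (generator w) {u}"
      unfolding c[OF uw(2)] by (rule coeff_T[OF uw(1), symmetric])
    then show "(\<Sum>v\<in>L. A u v * c w (T v)) = of_bool (u = w)"
      by (simp add: generator.rep_eq)
  qed
qed

lemma left_inverse_eq_right_inverse:
  fixes A B G :: "'v \<Rightarrow> 'v \<Rightarrow> real"
  assumes "finite L" "u \<in> L" "v \<in> L"
    and B: "\<And>u v. u \<in> L \<Longrightarrow> v \<in> L \<Longrightarrow> (\<Sum>w\<in>L. B u w * A w v) = of_bool (u = v)"
    and G: "\<And>u v. u \<in> L \<Longrightarrow> v \<in> L \<Longrightarrow> (\<Sum>w\<in>L. A u w * G w v) = of_bool (u = v)"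
  shows "B u v = G u v"
proof -
  have "B u v = (\<Sum>w\<in>L. B u w * of_bool (w = v))" using assms(1,3) by simp
  also have "\<dots> = (\<Sum>w\<in>L. \<Sum>x\<in>L. B u w * A w x * G x v)"
    by (rule sum.cong) (simp_all add: assms(3) sum_distrib_left mult.assoc flip: G)
  also have "\<dots> = (\<Sum>x\<in>L. (\<Sum>w\<in>L. B u w * A w x) * G x v)"
    by (subst sum.swap) (simp add: sum_distrib_right)
  also have "\<dots> = (\<Sum>x\<in>L. of_bool (u = x) * G x v)" by (rule sum.cong) (simp_all add: B assms(2))
  also have "\<dots> = G u v" using assms(1,2) by simp
  finally show ?thesis .
qed

text \<open>
  The Laplacian is symmetric, so the transpose of a right inverse is a left inverse. Hence the
  two agree, which gives the symmetry, the existence and the uniqueness of the inverse.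
\<close>

lemma green_function_inverse:
  fixes L :: "(int ^ 'd) set"
  assumes fin: "finite L" and "u \<in> L" "v \<in> L"
  shows "(\<Sum>w\<in>L. - laplacian u w * green_function L w v) = of_bool (u = v)"
    and "green_function L u v = green_function L v u"
proof -
  let ?A = "\<lambda>u v. - laplacian u v :: real"
  have inj: "f v = 0" if "\<And>u. u \<in> L \<Longrightarrow> (\<Sum>v\<in>L. ?A u v * f v) = 0" "v \<in> L" for f v
    using fin _ that(2) by (rule dirichlet_laplacian_injective) (use that(1) in \<open>simp add: sum_negf\<close>)
  obtain G\<^sub>0 where G\<^sub>0: "\<And>u w. u \<in> L \<Longrightarrow> w \<in> L \<Longrightarrow> (\<Sum>v\<in>L. ?A u v * G\<^sub>0 v w) = of_bool (u = w)"
  proof (rule injective_matrix_right_inverse[OF fin, of ?A])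
    show "f v = 0" if "\<And>u. u \<in> L \<Longrightarrow> (\<Sum>v\<in>L. ?A u v * f v) = 0" "v \<in> L" for f v
      using that by (rule inj)
  qed (rule that)
  define G where "G u v = (if u \<in> L \<and> v \<in> L then G\<^sub>0 u v else 0)" for u v
  have right: "(\<Sum>v\<in>L. ?A u v * G v w) = of_bool (u = w)" if "u \<in> L" "w \<in> L" for u w
    using G\<^sub>0[OF that] that by (simp add: G_def)
  have left_transpose: "(\<Sum>w\<in>L. G w u * ?A w v) = of_bool (u = v)" if "u \<in> L" "v \<in> L" for u v
  proof -
    have "(\<Sum>w\<in>L. G w u * ?A w v) = (\<Sum>w\<in>L. ?A v w * G w u)"
      by (intro sum.cong refl) (simp add: laplacian_sym[of v] mult.commute)
    also have "\<dots> = of_bool (v = u)" by (rule right[OF that(2,1)])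
    finally show ?thesis by (simp only: eq_commute[of u v])
  qed
  have sym: "G v u = G u v" if "u \<in> L" "v \<in> L" for u v
    by (rule left_inverse_eq_right_inverse[OF fin that, where B = "\<lambda>u v. G v u" and A = ?A])
      (erule (1) left_transpose, erule (1) right)
  have left: "(\<Sum>w\<in>L. G u w * ?A w v) = of_bool (u = v)" if "u \<in> L" "v \<in> L" for u v
  proof -
    have "(\<Sum>w\<in>L. G u w * ?A w v) = (\<Sum>w\<in>L. G w u * ?A w v)"
      by (intro sum.cong refl) (simp only: sym[OF that(1)])
    then show ?thesis using left_transpose[OF that] by simp
  qed
  have green: "green_function L = G"
    unfolding green_function_def inverse_on_def
  proof (rule the_equality)
    show "(\<forall>u v. u \<notin> L \<or> v \<notin> L \<longrightarrow> G u v = 0) \<and>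
        (\<forall>u\<in>L. \<forall>v\<in>L. (\<Sum>w\<in>L. ?A u w * G w v) = of_bool (u = v)) \<and>
        (\<forall>u\<in>L. \<forall>v\<in>L. (\<Sum>w\<in>L. G u w * ?A w v) = of_bool (u = v))"
      by (intro conjI allI ballI impI left right) (auto simp: G_def)
    fix B
    assume B: "(\<forall>u v. u \<notin> L \<or> v \<notin> L \<longrightarrow> B u v = 0) \<and>
        (\<forall>u\<in>L. \<forall>v\<in>L. (\<Sum>w\<in>L. ?A u w * B w v) = of_bool (u = v)) \<and>
        (\<forall>u\<in>L. \<forall>v\<in>L. (\<Sum>w\<in>L. B u w * ?A w v) = of_bool (u = v))"
    have B_left: "(\<Sum>w\<in>L. B u w * ?A w v) = of_bool (u = v)" if "u \<in> L" "v \<in> L" for u v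
      using bspec[OF bspec[OF conjunct2[OF conjunct2[OF B]] that(1)] that(2)] .
    have inside: "B u v = G u v" if "u \<in> L" "v \<in> L" for u v
      by (rule left_inverse_eq_right_inverse[OF fin that, where A = ?A])
        (erule (1) B_left, erule (1) right)
    show "B = G"
    proof (intro ext)
      fix u v
      show "B u v = G u v"
      proof (cases "u \<in> L \<and> v \<in> L")
        case True
        then show ?thesis by (intro inside) simp_all
      next
        case False
        then have "u \<notin> L \<or> v \<notin> L" by simp
        then have "B u v = 0" by (rule conjunct1[OF B, rule_format])
        then show ?thesis using False by (simp only: G_def if_False)
      qed
    qed
  qed
  show "(\<Sum>w\<in>L. - laplacian u w * green_function L w v) = of_bool (u = v)"
    unfolding green by (rule right[OF assms(2,3)])
  show "green_function L u v = green_function L v u"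
    unfolding green by (rule sym[OF assms(3,2)])
qed

section \<open>Products of determinants over disjoint index sets\<close>

text \<open>
  Permutations of \<open>A \<union> U\<close> that map \<open>A\<close> to itself are pairs of a permutation of \<open>A\<close> and one of \<open>U\<close>, and
  sign and product of entries are multiplicative. The condition \<open>Q\<close>, which depends only on the values
  on \<open>U\<close>, stands for the blocks into which \<open>U\<close> has been divided already.
\<close>

lemma det_on_mult_disjoint:
  assumes fin: "finite A" "finite U" and disj: "A \<inter> U = {}"
    and Q: "\<And>\<rho> \<rho>'. (\<And>f. f \<in> U \<Longrightarrow> \<rho> f = \<rho>' f) \<Longrightarrow> Q \<rho> \<longleftrightarrow> Q \<rho>'"
  shows "det_on A M * (\<Sum>\<rho> | \<rho> permutes U \<and> Q \<rho>. of_int (sign \<rho>) * (\<Prod>f\<in>U. M f (\<rho> f))) =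
    (\<Sum>\<tau> | \<tau> permutes (A \<union> U) \<and> (\<forall>f\<in>A. \<tau> f \<in> A) \<and> Q \<tau>.
      of_int (sign \<tau>) * (\<Prod>f\<in>A \<union> U. M f (\<tau> f)))"
proof -
  let ?t = "\<lambda>E \<tau>. of_int (sign \<tau>) * (\<Prod>f\<in>E. M f (\<tau> f))"
  let ?S = "{\<sigma>. \<sigma> permutes A} \<times> {\<rho>. \<rho> permutes U \<and> Q \<rho>}"
  have comp: "(\<sigma> \<circ> \<rho>) f = (if f \<in> A then \<sigma> f else \<rho> f)" if "\<sigma> permutes A" "\<rho> permutes U" for \<sigma> \<rho> f
    using that disj permutes_not_in[OF that(1)] permutes_not_in[OF that(2)]
      permutes_in_image[OF that(2), of f] by (auto simp: disjoint_iff)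
  have "det_on A M * (\<Sum>\<rho> | \<rho> permutes U \<and> Q \<rho>. ?t U \<rho>) = (\<Sum>(\<sigma>, \<rho>)\<in>?S. ?t A \<sigma> * ?t U \<rho>)"
    unfolding det_on_def sum_product by (simp add: sum.cartesian_product)
  also have "\<dots> = (\<Sum>\<tau> | \<tau> permutes (A \<union> U) \<and> (\<forall>f\<in>A. \<tau> f \<in> A) \<and> Q \<tau>. ?t (A \<union> U) \<tau>)"
  proof (rule sum.reindex_bij_witness[where i = "\<lambda>\<tau>. (restrict_id \<tau> A, restrict_id \<tau> U)"
        and j = "\<lambda>(\<sigma>, \<rho>). \<sigma> \<circ> \<rho>"])
    fix a assume "a \<in> ?S"
    then obtain \<sigma> \<rho> where a: "a = (\<sigma>, \<rho>)" and \<sigma>: "\<sigma> permutes A" and \<rho>: "\<rho> permutes U" and "Q \<rho>"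
      by auto
    note c = comp[OF \<sigma> \<rho>]
    have U: "f \<in> U \<Longrightarrow> f \<notin> A" for f using disj by auto
    show "(restrict_id ((\<lambda>(\<sigma>, \<rho>). \<sigma> \<circ> \<rho>) a) A, restrict_id ((\<lambda>(\<sigma>, \<rho>). \<sigma> \<circ> \<rho>) a) U) = a"
      using U permutes_not_in[OF \<sigma>] permutes_not_in[OF \<rho>]
      by (auto simp: a restrict_id_def c fun_eq_iff simp del: o_apply)
    have "\<sigma> \<circ> \<rho> permutes (A \<union> U)"
      using \<sigma> \<rho> by (intro permutes_compose) (auto intro: permutes_subset)
    moreover have "Q (\<sigma> \<circ> \<rho>) \<longleftrightarrow> Q \<rho>"
      by (rule Q) (auto simp: c U simp del: o_apply)
    ultimately show "(\<lambda>(\<sigma>, \<rho>). \<sigma> \<circ> \<rho>) a \<in> {\<tau>. \<tau> permutes (A \<union> U) \<and> (\<forall>f\<in>A. \<tau> f \<in> A) \<and> Q \<tau>}"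
      using \<open>Q \<rho>\<close> permutes_in_image[OF \<sigma>] by (auto simp: a c simp del: o_apply)
    have "sign (\<sigma> \<circ> \<rho>) = sign \<sigma> * sign \<rho>"
      using \<sigma> \<rho> fin by (intro sign_compose permutes_imp_permutation)
    moreover have "(\<Prod>f\<in>A \<union> U. M f ((\<sigma> \<circ> \<rho>) f)) = (\<Prod>f\<in>A. M f (\<sigma> f)) * (\<Prod>f\<in>U. M f (\<rho> f))"
      using fin disj by (subst prod.union_disjoint) (auto simp: c U simp del: o_apply)
    ultimately show "?t (A \<union> U) ((\<lambda>(\<sigma>, \<rho>). \<sigma> \<circ> \<rho>) a) = (case a of (\<sigma>, \<rho>) \<Rightarrow> ?t A \<sigma> * ?t U \<rho>)"
      by (simp add: a)
  next
    fix \<tau> assume "\<tau> \<in> {\<tau>. \<tau> permutes (A \<union> U) \<and> (\<forall>f\<in>A. \<tau> f \<in> A) \<and> Q \<tau>}"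
    then have \<tau>: "\<tau> permutes (A \<union> U)" and A: "\<tau> ` A \<subseteq> A" and "Q \<tau>" by auto
    have inj: "inj_on \<tau> X" for X by (rule inj_on_subset[OF permutes_inj[OF \<tau>]]) simp
    have A_eq: "\<tau> ` A = A" using fin A inj by (intro endo_inj_surj)
    have "\<tau> ` U = U"
    proof -
      have "\<tau> ` (A \<union> U) = A \<union> U" by (rule permutes_image[OF \<tau>])
      moreover have "\<tau> ` A \<inter> \<tau> ` U = {}"
        using permutes_inj[OF \<tau>] disj by (metis image_Int image_empty)
      ultimately have "A \<union> \<tau> ` U = A \<union> U" "A \<inter> \<tau> ` U = {}" using A_eq by (simp_all add: image_Un)
      then have "A \<union> \<tau> ` U - A = A \<union> U - A" "\<tau> ` U - A = \<tau> ` U" by auto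
      then show ?thesis using disj by (simp add: Un_Diff Diff_triv Int_commute)
    qed
    with A_eq have perms: "restrict_id \<tau> A permutes A" "restrict_id \<tau> U permutes U"
      using inj by (auto intro!: permutes_restrict_id simp: bij_betw_def)
    have "Q (restrict_id \<tau> U) \<longleftrightarrow> Q \<tau>" by (rule Q) simp
    with perms \<open>Q \<tau>\<close> show "(restrict_id \<tau> A, restrict_id \<tau> U) \<in> ?S" by simp
    show "(\<lambda>(\<sigma>, \<rho>). \<sigma> \<circ> \<rho>) (restrict_id \<tau> A, restrict_id \<tau> U) = \<tau>"
    proof
      fix f
      have "\<tau> f = f" if "f \<notin> A" "f \<notin> U" using permutes_not_in[OF \<tau>] that by auto
      then show "(\<lambda>(\<sigma>, \<rho>). \<sigma> \<circ> \<rho>) (restrict_id \<tau> A, restrict_id \<tau> U) f = \<tau> f"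
        using comp[OF perms, of f] by (auto simp: restrict_id_def)
    qed
  qed
  finally show ?thesis .
qed

lemma prod_det_on:
  assumes "finite P" "\<And>B. B \<in> P \<Longrightarrow> finite (F B)" "disjoint_family_on F P"
  shows "(\<Prod>B\<in>P. det_on (F B) M) =
    (\<Sum>\<tau> | \<tau> permutes (\<Union>B\<in>P. F B) \<and> (\<forall>B\<in>P. \<forall>f\<in>F B. \<tau> f \<in> F B).
      of_int (sign \<tau>) * (\<Prod>f\<in>(\<Union>B\<in>P. F B). M f (\<tau> f)))"
  using assms
proof (induction P)
  case (insert B P)
  let ?U = "\<Union>B\<in>P. F B"
  have "F B \<inter> ?U = {}"
    using insert.prems(2) insert.hyps(2) by (auto simp: disjoint_family_on_def)
  moreover have "disjoint_family_on F P"
    using insert.prems(2) by (rule disjoint_family_on_mono[rotated]) auto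
  ultimately have "(\<Prod>B\<in>insert B P. det_on (F B) M) =
      (\<Sum>\<tau> | \<tau> permutes (F B \<union> ?U) \<and> (\<forall>f\<in>F B. \<tau> f \<in> F B) \<and> (\<forall>B\<in>P. \<forall>f\<in>F B. \<tau> f \<in> F B).
        of_int (sign \<tau>) * (\<Prod>f\<in>F B \<union> ?U. M f (\<tau> f)))"
  proof (subst det_on_mult_disjoint[symmetric])
    show "(\<forall>B\<in>P. \<forall>f\<in>F B. \<rho> f \<in> F B) \<longleftrightarrow> (\<forall>B\<in>P. \<forall>f\<in>F B. \<rho>' f \<in> F B)"
      if "\<And>f. f \<in> ?U \<Longrightarrow> \<rho> f = \<rho>' f" for \<rho> \<rho>'
      by (intro ball_cong refl, subst that) auto
  qed (use insert in auto)
  then show ?case by simp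
qed simp

section \<open>Sums over partitions\<close>

text \<open>
  The value of the Moebius function of the partition lattice between \<open>P\<close> and the partition with one
  block.
\<close>

definition moebius_weight :: "'a set set \<Rightarrow> real" where
  "moebius_weight P = fact (card P - 1) * (- 1) ^ (card P - 1)"

text \<open>
  Let \<open>Q\<close> have \<open>k\<close> blocks. Taking \<open>C\<close> as a block of its own, written as \<open>B = {}\<close>, contributes
  \<open>(-1)^k k!\<close>. Merging \<open>C\<close> with one of the \<open>k\<close> blocks contributes \<open>(-1)^(k-1) (k-1)!\<close> each time.
\<close>

lemma moebius_weight_extensions:
  assumes "finite Q" "{} \<notin> Q" "Q \<noteq> {}" "C \<noteq> {}" "\<And>B. B \<in> Q \<Longrightarrow> B \<inter> C = {}"
  shows "(\<Sum>B\<in>insert {} Q. moebius_weight (insert (B \<union> C) (Q - {B}))) = 0"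
proof -
  have "B \<union> C \<notin> Q" for B using assms(4) assms(5)[of "B \<union> C"] by auto
  then have card: "card (insert (B \<union> C) (Q - {B})) = (if B = {} then Suc (card Q) else card Q)"
    if "B \<in> insert {} Q" for B
    using that assms(1,2) card_gt_0_iff[of Q] by (auto simp: card_insert_if card_Suc_Diff1)
  obtain k where k: "card Q = Suc k" using assms(1,3) by (metis card_eq_0_iff not0_implies_Suc)
  have "moebius_weight (insert ({} \<union> C) (Q - {{}})) = fact (Suc k) * (- 1) ^ Suc k"
    using card[of "{}"] k by (simp add: moebius_weight_def del: fact_Suc)
  moreover have "(\<Sum>B\<in>Q. moebius_weight (insert (B \<union> C) (Q - {B}))) = (\<Sum>B\<in>Q. fact k * (- 1) ^ k)"
  proof (rule sum.cong[OF refl])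
    fix B assume "B \<in> Q"
    moreover from this have "B \<noteq> {}" using assms(2) by auto
    ultimately show "moebius_weight (insert (B \<union> C) (Q - {B})) = fact k * (- 1) ^ k"
      using card[of B] k by (simp add: moebius_weight_def)
  qed
  ultimately have "(\<Sum>B\<in>insert {} Q. moebius_weight (insert (B \<union> C) (Q - {B}))) =
      fact (Suc k) * (- 1) ^ Suc k + (\<Sum>B\<in>Q. fact k * (- 1) ^ k)"
    by (simp only: sum.insert[OF assms(1,2)])
  also have "\<dots> = 0" by (simp add: k)
  finally show ?thesis .
qed

text \<open>
  Here \<open>K\<close> stands for the sets that are unions of components of some graph, and \<open>C\<close> is a component.
  An admissible partition of \<open>V\<close> arises in exactly one way from an admissible partition \<open>Q\<close> of
  \<open>V - C\<close>, by adding \<open>C\<close> as a new block or merging it with a block of \<open>Q\<close>. The weights of the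
  partitions that arise from the same \<open>Q\<close> cancel.
\<close>

lemma sum_moebius_weight_eq_0:
  assumes "finite V" and C: "C \<subseteq> V" "C \<noteq> {}" "C \<noteq> V" "K C"
    and K_Un: "\<And>A B. K A \<Longrightarrow> K B \<Longrightarrow> K (A \<union> B)" and K_Diff: "\<And>A B. K A \<Longrightarrow> K B \<Longrightarrow> K (A - B)"
    and K_C: "\<And>A. K A \<Longrightarrow> C \<subseteq> A \<or> C \<inter> A = {}"
  shows "(\<Sum>P | partition_on V P \<and> (\<forall>B\<in>P. K B). moebius_weight P) = 0"
proof -
  let ?parts = "\<lambda>W. {P. partition_on W P \<and> (\<forall>B\<in>P. K B)}"
  let ?ext = "\<lambda>(Q, B). insert (B \<union> C) (Q - {B})"
  let ?S = "SIGMA Q:?parts (V - C). insert {} Q"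
  have fin: "finite (?parts W)" if "finite W" for W
    using finitely_many_partition_on[OF that] by (rule rev_finite_subset) auto
  have sep: "B \<inter> C = {}" if "partition_on (V - C) Q" "B \<in> insert {} Q" for Q B
    using that by (auto simp: partition_on_def)
  have "bij_betw ?ext ?S (?parts V)"
    unfolding bij_betw_def
  proof
    show "inj_on ?ext ?S"
    proof (rule inj_onI)
      fix a a' assume "a \<in> ?S" "a' \<in> ?S" and eq: "?ext a = ?ext a'"
      then obtain Q B Q' B' where a: "a = (Q, B)" "a' = (Q', B')"
        and Q: "partition_on (V - C) Q" "B \<in> insert {} Q"
        and Q': "partition_on (V - C) Q'" "B' \<in> insert {} Q'" by auto
      have blocks: "{D \<in> ?ext (R, A). D \<inter> C \<noteq> {}} = {A \<union> C}"
        "{D \<in> ?ext (R, A). D \<inter> C = {}} = R - {A}"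
        if "partition_on (V - C) R" "A \<in> insert {} R" for R A
        using sep[OF that(1)] that(2) C(2) by auto
      have "A \<union> C - C = A" if "partition_on (V - C) R" "A \<in> insert {} R" for R A
        using sep[OF that] by auto
      with blocks[OF Q] blocks[OF Q'] eq have "B = B'" "Q - {B} = Q' - {B'}"
        using Q Q' by (metis a singleton_inject)+
      moreover have "{} \<notin> Q" "{} \<notin> Q'" using Q(1) Q'(1) by (auto simp: partition_on_def)
      ultimately show "a = a'" using Q(2) Q'(2) unfolding a by (cases "B = {}") auto
    qed
    show "?ext ` ?S = ?parts V"
    proof (intro equalityI subsetI)
      fix P assume "P \<in> ?ext ` ?S"
      then obtain Q B where P: "P = insert (B \<union> C) (Q - {B})"
        and Q: "partition_on (V - C) Q" "\<forall>B\<in>Q. K B" "B \<in> insert {} Q" by auto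
      have "K (B \<union> C)" using Q C(4) K_Un[of B C] by auto
      moreover have "partition_on V P"
        unfolding P
      proof (subst partition_on_insert)
        show "disjnt (B \<union> C) (\<Union> (Q - {B}))"
        proof -
          have "A \<inter> B = {}" "A \<inter> C = {}" if "A \<in> Q - {B}" for A
            using Q that sep[OF Q(1), of A] by (auto simp: partition_on_def dest: disjointD)
          then show ?thesis by (auto simp: disjnt_iff)
        qed
        have "partition_on (V - (B \<union> C)) (Q - {B})"
        proof (cases "B = {}")
          case True
          then show ?thesis using Q by (auto simp: partition_on_def)
        next
          case False
          then have B: "B \<in> Q" using Q by auto
          then have "disjnt B (\<Union> (Q - {B}))"
            using Q(1) by (auto simp: partition_on_def disjnt_iff disjoint_def)
          then have "partition_on (V - C - B) (Q - {B})"
            using partition_on_insert[of B "Q - {B}" "V - C"] Q(1) B by (simp add: insert_absorb)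
          moreover have "V - C - B = V - (B \<union> C)" by auto
          ultimately show ?thesis by simp
        qed
        then show "partition_on (V - (B \<union> C)) (Q - {B}) \<and> B \<union> C \<subseteq> V \<and> B \<union> C \<noteq> {}"
          using Q C by (auto simp: partition_on_def)
      qed
      ultimately show "P \<in> ?parts V" using Q(2) by (auto simp: P)
    next
      fix P assume "P \<in> ?parts V"
      then have P: "partition_on V P" and KP: "\<And>B. B \<in> P \<Longrightarrow> K B" by auto
      obtain x where x: "x \<in> C" using C(2) by blast
      then obtain D where D: "D \<in> P" "x \<in> D" using C(1) P by (auto simp: partition_on_def)
      then have CD: "C \<subseteq> D" using K_C[OF KP[OF D(1)]] x by auto
      define B where "B = D - C"
      define Q where "Q = (P - {D}) \<union> ({B} - {{}})"
      have sepD: "A \<inter> D = {}" if "A \<in> P - {D}" for A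
        using that P D(1) by (auto simp: partition_on_def disjoint_def)
      have rest: "partition_on (V - D) (P - {D})"
      proof -
        have "disjnt D (\<Union> (P - {D}))" using sepD by (auto simp: disjnt_iff)
        then show ?thesis
          using partition_on_insert[of D "P - {D}" V] P D(1) by (simp add: insert_absorb)
      qed
      have "partition_on (V - C) Q"
      proof (cases "B = {}")
        case True
        then have "D = C" using CD by (auto simp: B_def)
        then show ?thesis using rest True by (simp add: Q_def)
      next
        case False
        have "Q = insert B (P - {D})" using False by (auto simp: Q_def)
        moreover have "V - C - B = V - D" using CD by (auto simp: B_def)
        moreover have "disjnt B (\<Union> (P - {D}))" using sepD by (auto simp: disjnt_iff B_def)
        moreover have "B \<subseteq> V - C" using D(1) P by (auto simp: B_def partition_on_def)
        ultimately show ?thesis using rest False by (simp add: partition_on_insert)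
      qed
      moreover have "K B" unfolding B_def by (intro K_Diff KP D C)
      moreover have "?ext (Q, B) = P"
      proof -
        have "B \<notin> P - {D}" if "B \<noteq> {}" using sepD[of B] that by (auto simp: B_def)
        moreover have "{} \<notin> P" using P by (auto simp: partition_on_def)
        moreover have "B \<union> C = D" using CD by (auto simp: B_def)
        ultimately show ?thesis using D(1) by (auto simp: Q_def)
      qed
      ultimately show "P \<in> ?ext ` ?S"
        using KP by (intro image_eqI[of _ _ "(Q, B)"]) (auto simp: Q_def)
    qed
  qed
  then have "(\<Sum>P\<in>?parts V. moebius_weight P) = (\<Sum>a\<in>?S. moebius_weight (?ext a))"
    by (rule sum.reindex_bij_betw[symmetric])
  also have "\<dots> = (\<Sum>Q\<in>?parts (V - C). \<Sum>B\<in>insert {} Q. moebius_weight (insert (B \<union> C) (Q - {B})))"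
  proof (subst sum.Sigma)
    show "finite (?parts (V - C))" using assms(1) by (intro fin) simp
    show "\<forall>Q\<in>?parts (V - C). finite (insert {} Q)"
      using assms(1) finite_elements[of "V - C"] by auto
  qed (simp add: case_prod_unfold)
  also have "\<dots> = 0"
  proof (rule sum.neutral, rule ballI, rule moebius_weight_extensions)
    fix Q assume "Q \<in> ?parts (V - C)"
    then have Q: "partition_on (V - C) Q" by simp
    show "finite Q" using assms(1) Q by (auto intro: finite_elements)
    show "{} \<notin> Q" "Q \<noteq> {}" using Q C by (auto simp: partition_on_def)
    show "C \<noteq> {}" by (rule C)
    show "B \<inter> C = {}" if "B \<in> Q" for B using sep[OF Q] that by auto
  qed
  finally show ?thesis .
qed

text \<open>
  If the graph of \<open>R\<close> is connected, only the partition with one block is left, and it has weight one.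
  Otherwise the component of a vertex is a proper subset of \<open>V\<close> and the preceding cancellation applies.
\<close>

lemma sum_moebius_weight_connected:
  assumes "finite V" "V \<noteq> {}" "R \<subseteq> V \<times> V" "sym R"
    and K: "\<And>B. K B \<longleftrightarrow> (\<forall>(x, y)\<in>R. x \<in> B \<longrightarrow> y \<in> B)"
  shows "(\<Sum>P | partition_on V P \<and> (\<forall>B\<in>P. K B). moebius_weight P) =
    of_bool (\<forall>v\<in>V. \<forall>w\<in>V. (v, w) \<in> R\<^sup>*)"
proof -
  have invariant: "y \<in> B" if "K B" "(x, y) \<in> R\<^sup>*" "x \<in> B" for B x y
    using that(2,3) by (induction rule: rtrancl_induct) (use that(1) K in auto)
  have sym_closure: "(y, x) \<in> R\<^sup>*" if "(x, y) \<in> R\<^sup>*" for x y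
    using that sym_rtrancl[OF assms(4)] by (rule symD[rotated])
  show ?thesis
  proof (cases "\<forall>v\<in>V. \<forall>w\<in>V. (v, w) \<in> R\<^sup>*")
    case True
    have "{P. partition_on V P \<and> (\<forall>B\<in>P. K B)} = {{V}}"
    proof (intro equalityI subsetI)
      fix P assume "P \<in> {P. partition_on V P \<and> (\<forall>B\<in>P. K B)}"
      then have P: "\<Union>P = V" "{} \<notin> P" and KP: "\<And>B. B \<in> P \<Longrightarrow> K B"
        by (auto simp: partition_on_def)
      have "B = V" if B: "B \<in> P" for B
      proof -
        obtain x where "x \<in> B" using B P(2) by (cases "B = {}") auto
        have "B \<subseteq> V" using B P(1) by auto
        moreover have "y \<in> B" if "y \<in> V" for y
          using True \<open>x \<in> B\<close> \<open>B \<subseteq> V\<close> that by (intro invariant[OF KP[OF B], of x y]) auto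
        ultimately show ?thesis by auto
      qed
      then show "P \<in> {{V}}" using P assms(2) by auto
    next
      fix P assume "P \<in> {{V}}"
      then show "P \<in> {P. partition_on V P \<and> (\<forall>B\<in>P. K B)}"
        using partition_on_space[OF assms(2)] assms(3) K by auto
    qed
    then show ?thesis using True by (simp add: moebius_weight_def)
  next
    case False
    then obtain v w where vw: "v \<in> V" "w \<in> V" "(v, w) \<notin> R\<^sup>*" by blast
    define C where "C = {x. (v, x) \<in> R\<^sup>*}"
    have C_V: "C \<subseteq> V"
    proof
      fix x assume "x \<in> C"
      then have "(v, x) \<in> R\<^sup>*" by (simp add: C_def)
      then show "x \<in> V" by (induction rule: rtrancl_induct) (use vw assms(3) in auto)
    qed
    have "(\<Sum>P | partition_on V P \<and> (\<forall>B\<in>P. K B). moebius_weight P) = 0"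
    proof (rule sum_moebius_weight_eq_0[OF assms(1) C_V])
      show "C \<noteq> {}" "C \<noteq> V" using vw by (auto simp: C_def)
      show "K C" unfolding K C_def by (auto intro: rtrancl_into_rtrancl)
      show "K (A \<union> B)" if "K A" "K B" for A B using that unfolding K by blast
      show "K (A - B)" if "K A" "K B" for A B
        using that symD[OF assms(4)] unfolding K by blast
      show "C \<subseteq> A \<or> C \<inter> A = {}" if "K A" for A
      proof (cases "C \<inter> A = {}")
        case False
        then obtain x where "(v, x) \<in> R\<^sup>*" "x \<in> A" by (auto simp: C_def)
        then have "v \<in> A" using invariant[OF that] sym_closure by blast
        then show ?thesis using invariant[OF that] by (auto simp: C_def)
      qed simp
    qed
    then show ?thesis using False by simp
  qed
qed

section \<open>Cumulants of determinantal sums\<close>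

definition star_covering :: "(int ^ 'd) set \<Rightarrow> ((int ^ 'd) \<times> (int ^ 'd)) set set" where
  "star_covering V = {E. E \<subseteq> edges_from V \<and> (\<forall>v\<in>V. card (edges_at E v) \<ge> 1)}"

lemma fst_edges_from: "f \<in> edges_from V \<Longrightarrow> fst f \<in> V"
  by (auto simp: edges_from_def star_edges_def)

lemma finite_star_edges: "finite (star_edges v)"
proof -
  have "star_edges v = (\<lambda>e. (v, v + e)) ` unit_vectors" by (auto simp: star_edges_def)
  then show ?thesis by (simp add: finite_unit_vectors)
qed

lemma finite_edges_from: "finite V \<Longrightarrow> finite (edges_from V)"
  by (simp add: edges_from_def finite_star_edges)

lemma edges_from_iff: "f \<in> edges_from V \<longleftrightarrow> fst f \<in> V \<and> snd f - fst f \<in> unit_vectors"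
proof -
  have "f \<in> edges_from V \<longleftrightarrow> (\<exists>v\<in>V. \<exists>e\<in>unit_vectors. f = (v, v + e))"
    by (auto simp: edges_from_def star_edges_def)
  also have "\<dots> \<longleftrightarrow> fst f \<in> V \<and> snd f - fst f \<in> unit_vectors"
    by (cases f) (force simp: algebra_simps intro: bexI[of _ "snd f - fst f"])
  finally show ?thesis .
qed

lemma edges_at_restrict: "v \<in> B \<Longrightarrow> edges_at {f \<in> E. fst f \<in> B} v = edges_at E v"
  by (auto simp: edges_at_def)

lemma finite_star_covering: "finite V \<Longrightarrow> finite (star_covering V)"
  by (rule finite_subset[of _ "Pow (edges_from V)"]) (auto simp: star_covering_def finite_edges_from)

text \<open>
  Choosing one edge set for each block is the same as choosing one edge set over \<open>V\<close>, because
  an edge determines its tail and hence its block.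
\<close>

lemma prod_sum_star_covering:
  fixes h :: "(int ^ 'd) set \<Rightarrow> ((int ^ 'd) \<times> (int ^ 'd)) set \<Rightarrow> real"
  assumes "finite V" "partition_on V P"
  shows "(\<Prod>B\<in>P. \<Sum>E\<in>star_covering B. h B E) =
    (\<Sum>E\<in>star_covering V. \<Prod>B\<in>P. h B {f \<in> E. fst f \<in> B})"
proof -
  have PV: "\<Union>P = V" and disj: "\<And>A B. A \<in> P \<Longrightarrow> B \<in> P \<Longrightarrow> A \<noteq> B \<Longrightarrow> A \<inter> B = {}"
    using assms(2) by (auto simp: partition_on_def disjoint_def)
  have finP: "finite P" using assms by (rule finite_elements)
  have finB: "finite B" if "B \<in> P" for B
    using that PV assms(1) by (metis Sup_upper finite_subset)
  have "(\<Prod>B\<in>P. \<Sum>E\<in>star_covering B. h B E) = (\<Sum>g\<in>PiE P star_covering. \<Prod>B\<in>P. h B (g B))"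
    using finP finB by (intro prod_sum_PiE finite_star_covering)
  also have "\<dots> = (\<Sum>E\<in>star_covering V. \<Prod>B\<in>P. h B {f \<in> E. fst f \<in> B})"
  proof (rule sum.reindex_bij_witness[where j = "\<lambda>g. \<Union>B\<in>P. g B"
        and i = "\<lambda>E. restrict (\<lambda>B. {f \<in> E. fst f \<in> B}) P"])
    fix g assume g: "g \<in> PiE P star_covering"
    have gB: "g B \<in> star_covering B" if "B \<in> P" for B using g that by auto
    have fst_g: "fst f \<in> B" if "B \<in> P" "f \<in> g B" for B f
      using gB[OF that(1)] that(2) by (auto simp: star_covering_def intro: fst_edges_from)
    have restr: "{f \<in> \<Union>B\<in>P. g B. fst f \<in> B} = g B" if B: "B \<in> P" for B
    proof (intro equalityI subsetI)
      fix f assume "f \<in> {f \<in> \<Union>B\<in>P. g B. fst f \<in> B}"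
      then obtain A where A: "A \<in> P" "f \<in> g A" "fst f \<in> B" by auto
      then have "A = B" using fst_g[OF A(1,2)] disj[OF A(1) B] by auto
      then show "f \<in> g B" using A(2) by simp
    qed (use B fst_g in auto)
    show "restrict (\<lambda>B. {f \<in> \<Union>B\<in>P. g B. fst f \<in> B}) P = g"
    proof
      fix B
      show "restrict (\<lambda>B. {f \<in> \<Union>B\<in>P. g B. fst f \<in> B}) P B = g B"
      proof (cases "B \<in> P")
        case True
        then show ?thesis by (simp only: restrict_apply' restr)
      next
        case False
        then show ?thesis using g by (auto simp: PiE_def extensional_def)
      qed
    qed
    show "(\<Union>B\<in>P. g B) \<in> star_covering V"
      unfolding star_covering_def
    proof (intro CollectI conjI ballI)
      show "(\<Union>B\<in>P. g B) \<subseteq> edges_from V"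
        using gB PV by (fastforce simp: star_covering_def edges_from_iff)
      fix v assume "v \<in> V"
      then obtain B where B: "B \<in> P" "v \<in> B" using PV by auto
      have "edges_at (\<Union>B\<in>P. g B) v = edges_at (g B) v"
        using edges_at_restrict[OF B(2), of "\<Union>B\<in>P. g B"] restr[OF B(1)] by simp
      then show "card (edges_at (\<Union>B\<in>P. g B) v) \<ge> 1"
        using gB[OF B(1)] B(2) by (simp add: star_covering_def)
    qed
    show "(\<Prod>B\<in>P. h B {f \<in> \<Union>B\<in>P. g B. fst f \<in> B}) = (\<Prod>B\<in>P. h B (g B))"
      by (rule prod.cong) (simp_all only: restr)
  next
    fix E assume E: "E \<in> star_covering V"
    show "restrict (\<lambda>B. {f \<in> E. fst f \<in> B}) P \<in> PiE P star_covering"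
    proof
      fix B assume B: "B \<in> P"
      then have "B \<subseteq> V" using PV by auto
      then show "restrict (\<lambda>B. {f \<in> E. fst f \<in> B}) P B \<in> star_covering B"
        using B E by (auto simp: star_covering_def edges_at_restrict edges_from_iff)
    qed simp
    have "fst f \<in> \<Union>P" if "f \<in> E" for f
      using that E PV by (auto simp: star_covering_def edges_from_iff)
    then show "(\<Union>B\<in>P. restrict (\<lambda>B. {f \<in> E. fst f \<in> B}) P B) = E" by auto
  qed
  finally show ?thesis .
qed

text \<open>
  Since the blocks of \<open>P\<close> cover \<open>V\<close> and are disjoint, \<open>\<tau>\<close> maps the edges over each block into
  themselves if and only if no edge of the multigraph of \<open>\<tau>\<close> leaves a block.
\<close>

lemma sum_block_preserving:
  assumes "finite V" "V \<noteq> {}" "E \<subseteq> edges_from V" "\<tau> permutes E"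
  shows "(\<Sum>P | partition_on V P \<and> (\<forall>B\<in>P. \<forall>f\<in>E. fst f \<in> B \<longrightarrow> fst (\<tau> f) \<in> B). moebius_weight P) =
    of_bool (\<tau> \<in> connected_permutations V E)"
proof -
  let ?R = "{(x, y). x \<in> V \<and> y \<in> V \<and> x \<noteq> y \<and> multigraph_edges E \<tau> x y \<noteq> {}}"
  let ?K = "\<lambda>B. \<forall>(x, y)\<in>?R. x \<in> B \<longrightarrow> y \<in> B"
  have \<tau>E: "f \<in> E \<Longrightarrow> \<tau> f \<in> E" for f using permutes_in_image[OF assms(4)] by simp
  have EV: "f \<in> E \<Longrightarrow> fst f \<in> V" for f using assms(3) fst_edges_from by blast
  have forward: "(fst f, fst (\<tau> f)) \<in> ?R" if "f \<in> E" "fst f \<noteq> fst (\<tau> f)" for f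
  proof -
    have "(f, \<tau> f) \<in> multigraph_edges E \<tau> (fst f) (fst (\<tau> f))"
      using that \<tau>E by (simp add: multigraph_edges_def edges_at_def)
    then show ?thesis using that \<tau>E EV by auto
  qed
  have sym: "sym ?R" by (auto simp: sym_def multigraph_edges_def)
  have "(\<forall>B\<in>P. \<forall>f\<in>E. fst f \<in> B \<longrightarrow> fst (\<tau> f) \<in> B) \<longleftrightarrow> (\<forall>B\<in>P. ?K B)" if P: "partition_on V P" for P
  proof
    assume pres: "\<forall>B\<in>P. \<forall>f\<in>E. fst f \<in> B \<longrightarrow> fst (\<tau> f) \<in> B"
    have backward: "fst f \<in> B" if "f \<in> E" "B \<in> P" "fst (\<tau> f) \<in> B" for f B
    proof -
      obtain A where A: "A \<in> P" "fst f \<in> A" using P EV[OF \<open>f \<in> E\<close>] by (auto simp: partition_on_def)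
      then have "fst (\<tau> f) \<in> A" using pres \<open>f \<in> E\<close> by blast
      then have "A = B" using disjointD[OF partition_onD2[OF P] A(1) \<open>B \<in> P\<close>] that(3) by auto
      then show ?thesis using A(2) by simp
    qed
    show "\<forall>B\<in>P. ?K B"
    proof (intro ballI, clarify)
      fix B x y assume B: "B \<in> P" "x \<in> B" and "multigraph_edges E \<tau> x y \<noteq> {}"
      then obtain f f' where "f \<in> E" "f' \<in> E" "fst f = x" "fst f' = y" "\<tau> f = f' \<or> \<tau> f' = f"
        by (auto simp: multigraph_edges_def edges_at_def)
      then show "y \<in> B" using backward[of f' B] pres B by blast
    qed
  next
    assume K: "\<forall>B\<in>P. ?K B"
    show "\<forall>B\<in>P. \<forall>f\<in>E. fst f \<in> B \<longrightarrow> fst (\<tau> f) \<in> B"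
    proof (intro ballI impI)
      fix B f assume *: "B \<in> P" "f \<in> E" "fst f \<in> B"
      show "fst (\<tau> f) \<in> B"
      proof (cases "fst f = fst (\<tau> f)")
        case True
        then show ?thesis using *(3) by (rule subst)
      next
        case False
        from bspec[OF bspec[OF K *(1)] forward[OF *(2) False]] *(3) show ?thesis
          by (simp only: prod.case)
      qed
    qed
  qed
  then have "{P. partition_on V P \<and> (\<forall>B\<in>P. \<forall>f\<in>E. fst f \<in> B \<longrightarrow> fst (\<tau> f) \<in> B)} =
      {P. partition_on V P \<and> (\<forall>B\<in>P. ?K B)}" by (intro Collect_cong conj_cong refl)
  then have "(\<Sum>P | partition_on V P \<and> (\<forall>B\<in>P. \<forall>f\<in>E. fst f \<in> B \<longrightarrow> fst (\<tau> f) \<in> B). moebius_weight P) =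
      (\<Sum>P | partition_on V P \<and> (\<forall>B\<in>P. ?K B). moebius_weight P)" by simp
  also have "\<dots> = of_bool (\<forall>v\<in>V. \<forall>w\<in>V. (v, w) \<in> ?R\<^sup>*)"
    using assms(1,2) sym by (intro sum_moebius_weight_connected) auto
  also have "\<dots> = of_bool (\<tau> \<in> connected_permutations V E)"
    using assms(4) by (simp add: connected_permutations_def)
  finally show ?thesis .
qed

text \<open>
  Cumulants of a family whose joint moments are sums of determinants over edge sets. The product of the
  determinants over the blocks of \<open>P\<close> is the sum over the permutations that preserve these blocks.
  Exchanging the sums leaves, for each permutation \<open>\<tau>\<close>, the sum of the Moebius weights of the partitions
  preserved by \<open>\<tau>\<close>, which selects the connected permutations.
\<close>

theorem determinantal_cumulant:
  fixes V :: "(int ^ 'd) set"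
  assumes "finite V" "V \<noteq> {}"
  shows "(\<Sum>P | partition_on V P. moebius_weight P *
      (\<Prod>B\<in>P. \<Sum>E\<in>star_covering B. (\<Prod>v\<in>B. k (edges_at E v)) * det_on E M)) =
    (\<Sum>E\<in>star_covering V. (\<Prod>v\<in>V. k (edges_at E v)) *
      (\<Sum>\<tau>\<in>connected_permutations V E. of_int (sign \<tau>) * (\<Prod>f\<in>E. M f (\<tau> f))))"
proof -
  let ?k = "\<lambda>E. \<Prod>v\<in>V. k (edges_at E v)"
  let ?t = "\<lambda>E \<tau>. of_int (sign \<tau>) * (\<Prod>f\<in>E. M f (\<tau> f)) :: real"
  let ?pres = "\<lambda>P E \<tau>. \<forall>B\<in>P. \<forall>f\<in>E. fst f \<in> B \<longrightarrow> fst (\<tau> f) \<in> B"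
  have finE: "finite E" if "E \<in> star_covering V" for E
    using that finite_edges_from[OF assms(1)] by (auto simp: star_covering_def intro: finite_subset)
  have block_prod: "(\<Prod>B\<in>P. \<Sum>E\<in>star_covering B. (\<Prod>v\<in>B. k (edges_at E v)) * det_on E M) =
      (\<Sum>E\<in>star_covering V. ?k E * (\<Sum>\<tau> | \<tau> permutes E \<and> ?pres P E \<tau>. ?t E \<tau>))"
    if P: "partition_on V P" for P
    unfolding prod_sum_star_covering[OF assms(1) P]
  proof (rule sum.cong[OF refl])
    fix E assume E: "E \<in> star_covering V"
    have PV: "\<Union>P = V" and disj: "\<And>A B. A \<in> P \<Longrightarrow> B \<in> P \<Longrightarrow> A \<noteq> B \<Longrightarrow> A \<inter> B = {}"
      using P by (auto simp: partition_on_def disjoint_def)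
    have finP: "finite P" using assms(1) P by (rule finite_elements)
    have finB: "\<forall>B\<in>P. finite B" using PV assms(1) by (metis Sup_upper finite_subset)
    have EV: "fst f \<in> \<Union>P" if "f \<in> E" for f
      using that E PV by (auto simp: star_covering_def edges_from_iff)
    then have U: "(\<Union>B\<in>P. {f \<in> E. fst f \<in> B}) = E" by auto
    have "(\<Prod>B\<in>P. \<Prod>v\<in>B. k (edges_at {f \<in> E. fst f \<in> B} v)) = (\<Prod>B\<in>P. \<Prod>v\<in>B. k (edges_at E v))"
      by (intro prod.cong refl) (simp add: edges_at_restrict)
    also have "\<dots> = ?k E"
      using prod.Union_disjoint[of P "\<lambda>v. k (edges_at E v)"] finB disj by (simp add: PV)
    finally have weights: "(\<Prod>B\<in>P. \<Prod>v\<in>B. k (edges_at {f \<in> E. fst f \<in> B} v)) = ?k E" .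
    have "(\<Prod>B\<in>P. det_on {f \<in> E. fst f \<in> B} M) =
        (\<Sum>\<tau> | \<tau> permutes E \<and> (\<forall>B\<in>P. \<forall>f\<in>{f \<in> E. fst f \<in> B}. \<tau> f \<in> {f \<in> E. fst f \<in> B}). ?t E \<tau>)"
      using prod_det_on[of P "\<lambda>B. {f \<in> E. fst f \<in> B}" M] finP finE[OF E] disj
      unfolding U by (force simp: disjoint_family_on_def)
    also have "{\<tau>. \<tau> permutes E \<and> (\<forall>B\<in>P. \<forall>f\<in>{f \<in> E. fst f \<in> B}. \<tau> f \<in> {f \<in> E. fst f \<in> B})} =
        {\<tau>. \<tau> permutes E \<and> ?pres P E \<tau>}"
      using permutes_in_image by fastforce
    finally show "(\<Prod>B\<in>P. (\<Prod>v\<in>B. k (edges_at {f \<in> E. fst f \<in> B} v)) * det_on {f \<in> E. fst f \<in> B} M) =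
        ?k E * (\<Sum>\<tau> | \<tau> permutes E \<and> ?pres P E \<tau>. ?t E \<tau>)"
      by (simp add: prod.distrib weights)
  qed
  let ?parts = "{P. partition_on V P}"
  have fin_parts: "finite ?parts" using assms(1) by (rule finitely_many_partition_on)
  have "(\<Sum>P\<in>?parts. moebius_weight P *
      (\<Prod>B\<in>P. \<Sum>E\<in>star_covering B. (\<Prod>v\<in>B. k (edges_at E v)) * det_on E M)) =
      (\<Sum>P\<in>?parts. \<Sum>E\<in>star_covering V. ?k E *
        (moebius_weight P * (\<Sum>\<tau> | \<tau> permutes E \<and> ?pres P E \<tau>. ?t E \<tau>)))"
  proof (rule sum.cong[OF refl])
    fix P assume "P \<in> ?parts"
    then have P: "partition_on V P" by simp
    show "moebius_weight P * (\<Prod>B\<in>P. \<Sum>E\<in>star_covering B. (\<Prod>v\<in>B. k (edges_at E v)) * det_on E M) =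
        (\<Sum>E\<in>star_covering V. ?k E *
          (moebius_weight P * (\<Sum>\<tau> | \<tau> permutes E \<and> ?pres P E \<tau>. ?t E \<tau>)))"
      unfolding block_prod[OF P] by (subst sum_distrib_left) (rule sum.cong[OF refl], rule mult.left_commute)
  qed
  also have "\<dots> = (\<Sum>E\<in>star_covering V. ?k E *
      (\<Sum>P\<in>?parts. moebius_weight P * (\<Sum>\<tau> | \<tau> permutes E \<and> ?pres P E \<tau>. ?t E \<tau>)))"
    by (subst sum.swap) (simp add: sum_distrib_left)
  also have "\<dots> = (\<Sum>E\<in>star_covering V. ?k E * (\<Sum>\<tau>\<in>connected_permutations V E. ?t E \<tau>))"
  proof (intro sum.cong refl arg_cong2[of _ _ _ _ "(*)"])
    fix E assume E: "E \<in> star_covering V"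
    let ?perms = "{\<tau>. \<tau> permutes E}"
    have fin_perms: "finite ?perms" using finE[OF E] by (rule finite_permutations)
    have "(\<Sum>P\<in>?parts. moebius_weight P * (\<Sum>\<tau> | \<tau> permutes E \<and> ?pres P E \<tau>. ?t E \<tau>)) =
        (\<Sum>P\<in>?parts. \<Sum>\<tau>\<in>?perms. if ?pres P E \<tau> then moebius_weight P * ?t E \<tau> else 0)"
      using fin_perms by (simp add: sum.inter_filter[symmetric] sum_distrib_left)
    also have "\<dots> = (\<Sum>\<tau>\<in>?perms. (\<Sum>P | partition_on V P \<and> ?pres P E \<tau>. moebius_weight P) * ?t E \<tau>)"
      using fin_parts by (subst sum.swap) (simp add: sum.inter_filter[symmetric] sum_distrib_right)
    also have "\<dots> = (\<Sum>\<tau>\<in>?perms. of_bool (\<tau> \<in> connected_permutations V E) * ?t E \<tau>)"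
      using E assms by (intro sum.cong refl) (simp add: sum_block_preserving star_covering_def)
    also have "\<dots> = (\<Sum>\<tau>\<in>connected_permutations V E. ?t E \<tau>)"
      using fin_perms
      by (intro sum.mono_neutral_cong_right) (auto simp: connected_permutations_def)
    finally show "(\<Sum>P\<in>?parts. moebius_weight P * (\<Sum>\<tau> | \<tau> permutes E \<and> ?pres P E \<tau>. ?t E \<tau>)) =
        (\<Sum>\<tau>\<in>connected_permutations V E. ?t E \<tau>)" .
  qed
  finally show ?thesis .
qed

section \<open>Expansion of the fields\<close>

lemma commuting_prod_Un:
  assumes "\<And>i j. W i * W j = W j * W i" "finite A" "finite B" "A \<inter> B = {}"
  shows "commuting_prod W (A \<union> B) = commuting_prod W A * commuting_prod W B"
  using assms(2,4)
proof (induction A)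
  case (insert x A)
  have "commuting_prod W (insert x (A \<union> B)) = W x * commuting_prod W (A \<union> B)"
    using insert.hyps insert.prems assms(3) by (intro commuting_prod_insert assms(1)) auto
  moreover have "commuting_prod W (insert x A) = W x * commuting_prod W A"
    using insert.hyps by (intro commuting_prod_insert assms(1))
  ultimately show ?case using insert by (simp add: mult.assoc)
qed simp

lemma sum_Pow_insert:
  fixes h :: "'a set \<Rightarrow> 'b::comm_monoid_add"
  assumes "finite S" "x \<notin> S"
  shows "(\<Sum>F\<in>Pow (insert x S). h F) = (\<Sum>F\<in>Pow S. h F) + (\<Sum>F\<in>Pow S. h (insert x F))"
proof -
  have "inj_on (insert x) (Pow S)" using assms(2) by (auto simp: inj_on_def)
  moreover have "Pow S \<inter> insert x ` Pow S = {}" using assms(2) by auto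
  ultimately show ?thesis
    using assms(1) by (simp add: Pow_insert sum.union_disjoint sum.reindex)
qed

text \<open>
  Since \<open>q e * (1 - q e) = q e\<close>, the product is the sum over \<open>e\<close> of \<open>q e\<close> times the factors \<open>1 - q f\<close> with
  \<open>f \<noteq> e\<close>. A set \<open>F\<close> is obtained once for each of its elements \<open>e\<close>, with \<open>card F - 1\<close> signs from the
  other ones. The proof adds one element \<open>x\<close> to \<open>S\<close> at a time and also keeps track of the expansion of the
  second factor alone.
\<close>

lemma square_zero_field_expansion:
  assumes "finite S" and comm: "\<And>e f. q e * q f = q f * q e" and sq: "\<And>e. q e * q e = 0"
  shows "(\<Sum>e\<in>S. q e) * commuting_prod (\<lambda>e. 1 - q e) S = - (\<Sum>F\<in>Pow S. local_weight F *\<^sub>R commuting_prod q F)"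
proof -
  let ?Y = "commuting_prod (\<lambda>e. 1 - q e)"
  let ?E = "\<lambda>S. \<Sum>F\<in>Pow S. (- 1) ^ card F *\<^sub>R commuting_prod q F"
  let ?Z = "\<lambda>S. \<Sum>F\<in>Pow S. local_weight F *\<^sub>R commuting_prod q F"
  have comm1: "(1 - q e) * (1 - q f) = (1 - q f) * (1 - q e)" for e f
    by (simp add: left_diff_distrib right_diff_distrib comm)
  have fin: "finite F" if "F \<in> Pow S" "finite S" for F S using that finite_subset by auto
  have "?Y S = ?E S \<and> (\<Sum>e\<in>S. q e) * ?Y S = - ?Z S"
    using assms(1)
  proof (induction S)
    case empty
    show ?case by (simp add: local_weight_def)
  next
    case (insert x S)
    have ins: "card (insert x F) = Suc (card F)" "commuting_prod q (insert x F) = q x * commuting_prod q F"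
      if "F \<in> Pow S" for F
    proof -
      have "finite F" "x \<notin> F" using that insert.hyps fin by auto
      then show "card (insert x F) = Suc (card F)" "commuting_prod q (insert x F) = q x * commuting_prod q F"
        by (simp_all add: commuting_prod_insert[OF comm])
    qed
    have E: "?E (insert x S) = ?E S - q x * ?E S"
      unfolding sum_Pow_insert[OF insert.hyps(1,2)]
      by (simp add: ins sum_distrib_left sum_negf)
    have Z: "?Z (insert x S) = ?Z S - q x * ?Z S - q x * ?E S"
    proof -
      have "local_weight (insert x F) *\<^sub>R commuting_prod q (insert x F) =
          - (q x * (local_weight F *\<^sub>R commuting_prod q F)) - q x * ((- 1) ^ card F *\<^sub>R commuting_prod q F)"
        if "F \<in> Pow S" for F
        using that by (simp add: ins local_weight_def algebra_simps)
      then show ?thesis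
        unfolding sum_Pow_insert[OF insert.hyps(1,2)]
        by (simp add: sum_distrib_left sum_negf sum_subtractf)
    qed
    have Y: "?Y (insert x S) = (1 - q x) * ?Y S"
      using insert.hyps by (simp add: commuting_prod_insert[OF comm1])
    have "(\<Sum>e\<in>S. q e) * q x = q x * (\<Sum>e\<in>S. q e)"
      by (simp add: sum_distrib_left sum_distrib_right comm)
    then have "(q x + (\<Sum>e\<in>S. q e)) * ((1 - q x) * ?Y S) =
        (q x - q x * q x) * ?Y S + (1 - q x) * ((\<Sum>e\<in>S. q e) * ?Y S)"
      by (simp add: algebra_simps) (simp add: mult.assoc[symmetric])
    also have "\<dots> = q x * ?E S - (1 - q x) * ?Z S"
      unfolding conjunct2[OF insert.IH] unfolding conjunct1[OF insert.IH] by (simp add: sq)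
    also have "\<dots> = - ?Z (insert x S)" unfolding Z by (simp add: left_diff_distrib)
    finally have "(\<Sum>e\<in>insert x S. q e) * ?Y (insert x S) = - ?Z (insert x S)"
      unfolding Y using insert.hyps by simp
    moreover have "?Y (insert x S) = ?E (insert x S)"
      unfolding Y E using insert.IH by (simp add: left_diff_distrib)
    ultimately show ?case by blast
  qed
  then show "(\<Sum>e\<in>S. q e) * ?Y S = - ?Z S" by blast
qed

text \<open>
  The gradients as functions of the edge, so that their products can be indexed by sets of edges.
\<close>

definition edge_psi :: "(int ^ 'd) \<times> (int ^ 'd) \<Rightarrow> (int ^ 'd) fermion grassmann" where
  "edge_psi f = generator (Psi (snd f)) - generator (Psi (fst f))"

definition edge_psi_bar :: "(int ^ 'd) \<times> (int ^ 'd) \<Rightarrow> (int ^ 'd) fermion grassmann" where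
  "edge_psi_bar f = generator (Psi_bar (snd f)) - generator (Psi_bar (fst f))"

abbreviation edge_pairs :: "((int ^ 'd) \<times> (int ^ 'd)) set \<Rightarrow> (int ^ 'd) fermion grassmann" where
  "edge_pairs \<equiv> commuting_prod (\<lambda>f. edge_psi f * edge_psi_bar f)"

lemma edge_forms_linear: "edge_psi f \<in> linear_forms" "edge_psi_bar f \<in> linear_forms"
  unfolding edge_psi_def edge_psi_bar_def by (intro linear_forms_combine generator_linear_form)+

lemma edge_pairs_commute:
  "(edge_psi f * edge_psi_bar f) * (edge_psi g * edge_psi_bar g) =
    (edge_psi g * edge_psi_bar g) * (edge_psi f * edge_psi_bar f)"
  by (intro pairs_commute edge_forms_linear)

lemma edge_pair_square: "(edge_psi f * edge_psi_bar f) * (edge_psi f * edge_psi_bar f) = 0"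
proof -
  have "(edge_psi f * edge_psi_bar f) * (edge_psi f * edge_psi_bar f) =
      (edge_psi f * edge_psi_bar f * edge_psi f) * edge_psi_bar f" by (simp only: mult.assoc)
  also have "edge_psi f * edge_psi_bar f * edge_psi f = edge_psi f * (edge_psi f * edge_psi_bar f)"
    by (rule pair_commutes_with_linear_form) (rule edge_forms_linear)+
  also have "\<dots> = 0" by (simp add: linear_form_square edge_forms_linear mult.assoc[symmetric])
  finally show ?thesis by simp
qed

lemma commuting_prod_reindex:
  assumes "\<And>i j. W i * W j = W j * W i" "finite S" "inj_on h S"
  shows "commuting_prod W (h ` S) = commuting_prod (\<lambda>e. W (h e)) S"
  using assms(2,3)
  by (induction S) (auto simp: commuting_prod_insert assms(1))

lemma X_Y_field_expansion:
  fixes v :: "int ^ 'd"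
  shows "X_field v * Y_field v =
    (\<Sum>F\<in>Pow (star_edges v). (- 1 / (2 * real CARD('d)) * local_weight F) *\<^sub>R edge_pairs F)"
proof -
  let ?q = "\<lambda>f. edge_psi f * edge_psi_bar f"
  let ?h = "\<lambda>e. (v, v + e)"
  have star: "star_edges v = ?h ` unit_vectors" by (auto simp: star_edges_def)
  have inj: "inj_on ?h unit_vectors" by (simp add: inj_on_def)
  have grad: "grad_psi e v * grad_psi_bar e v = ?q (?h e)" for e
    by (simp add: grad_psi_def grad_psi_bar_def edge_psi_def edge_psi_bar_def)
  have "X_field v = (1 / (2 * real CARD('d))) *\<^sub>R (\<Sum>f\<in>star_edges v. ?q f)"
    unfolding X_field_def star grad by (simp add: sum.reindex[OF inj])
  moreover have "Y_field v = commuting_prod (\<lambda>f. 1 - ?q f) (star_edges v)"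
    unfolding Y_field_def star grad
    by (rule commuting_prod_reindex[symmetric, OF _ finite_unit_vectors inj])
      (simp add: left_diff_distrib right_diff_distrib edge_pairs_commute)
  ultimately have "X_field v * Y_field v = (1 / (2 * real CARD('d))) *\<^sub>R
      ((\<Sum>f\<in>star_edges v. ?q f) * commuting_prod (\<lambda>f. 1 - ?q f) (star_edges v))" by simp
  also have "\<dots> = (1 / (2 * real CARD('d))) *\<^sub>R
      - (\<Sum>F\<in>Pow (star_edges v). local_weight F *\<^sub>R edge_pairs F)"
    by (subst square_zero_field_expansion)
      (simp_all add: finite_star_edges edge_pairs_commute edge_pair_square)
  finally show ?thesis by (simp add: scaleR_sum_right sum_negf)
qed

text \<open>
  Products over different tails involve disjoint sets of edges, and a set of edges starting in \<open>B\<close> is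
  the union of its parts at the points of \<open>B\<close>.
\<close>

lemma commuting_prod_star_sums:
  assumes "finite B"
    and expansion: "\<And>v. W v = (\<Sum>F\<in>Pow (star_edges v). k F *\<^sub>R edge_pairs F)"
    and comm: "\<And>v w. W v * W w = W w * W v"
  shows "commuting_prod W B =
    (\<Sum>E\<in>Pow (edges_from B). (\<Prod>v\<in>B. k (edges_at E v)) *\<^sub>R edge_pairs E)"
  using assms(1)
proof (induction B)
  case empty
  show ?case by (simp add: edges_from_def)
next
  case (insert v B)
  let ?S = "Pow (star_edges v) \<times> Pow (edges_from B)"
  have fst_star: "fst f = v" if "f \<in> star_edges v" for f using that by (auto simp: star_edges_def)
  have fst_B: "fst f \<in> B" if "f \<in> edges_from B" for f using that by (rule fst_edges_from)
  have "commuting_prod W (insert v B) = W v * commuting_prod W B"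
    using insert.hyps by (intro commuting_prod_insert comm)
  also have "\<dots> = (\<Sum>(F, E)\<in>?S. (k F *\<^sub>R edge_pairs F) * ((\<Prod>v\<in>B. k (edges_at E v)) *\<^sub>R edge_pairs E))"
    unfolding insert.IH expansion[of v] by (simp add: sum_product sum.cartesian_product)
  also have "\<dots> = (\<Sum>E\<in>Pow (edges_from (insert v B)).
      (\<Prod>v\<in>insert v B. k (edges_at E v)) *\<^sub>R edge_pairs E)"
  proof (rule sum.reindex_bij_witness[where j = "\<lambda>(F, E). F \<union> E"
        and i = "\<lambda>E. (edges_at E v, {f \<in> E. fst f \<in> B})"])
    fix a assume "a \<in> ?S"
    then obtain F E where a: "a = (F, E)" "F \<subseteq> star_edges v" "E \<subseteq> edges_from B" by auto
    have F: "fst f = v" if "f \<in> F" for f using subsetD[OF a(2) that] by (rule fst_star)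
    have E: "fst f \<in> B" if "f \<in> E" for f using subsetD[OF a(3) that] by (rule fst_B)
    have at_v: "edges_at (F \<union> E) v = F" using F E insert.hyps by (auto simp: edges_at_def)
    have at_B: "edges_at (F \<union> E) w = edges_at E w" if "w \<in> B" for w
      using that F insert.hyps by (auto simp: edges_at_def)
    show "(edges_at ((\<lambda>(F, E). F \<union> E) a) v, {f \<in> (\<lambda>(F, E). F \<union> E) a. fst f \<in> B}) = a"
      using F E insert.hyps at_v by (auto simp: a(1))
    show "(\<lambda>(F, E). F \<union> E) a \<in> Pow (edges_from (insert v B))"
      using a by (auto simp: edges_from_def)
    have "edge_pairs (F \<union> E) = edge_pairs F * edge_pairs E"
    proof (rule commuting_prod_Un[OF edge_pairs_commute])
      show "finite F" using a(2) finite_star_edges by (rule finite_subset)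
      show "finite E" using a(3) finite_edges_from[OF insert.hyps(1)] by (rule finite_subset)
      show "F \<inter> E = {}" using F E insert.hyps by auto
    qed
    then show "(\<Prod>w\<in>insert v B. k (edges_at ((\<lambda>(F, E). F \<union> E) a) w)) *\<^sub>R edge_pairs ((\<lambda>(F, E). F \<union> E) a) =
        (case a of (F, E) \<Rightarrow> (k F *\<^sub>R edge_pairs F) * ((\<Prod>v\<in>B. k (edges_at E v)) *\<^sub>R edge_pairs E))"
      using insert.hyps by (simp add: a(1) at_v at_B)
  next
    fix E assume "E \<in> Pow (edges_from (insert v B))"
    then have E: "E \<subseteq> edges_from (insert v B)" by simp
    then show "(\<lambda>(F, E). F \<union> E) (edges_at E v, {f \<in> E. fst f \<in> B}) = E"
      using fst_edges_from by (auto simp: edges_at_def)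
    show "(edges_at E v, {f \<in> E. fst f \<in> B}) \<in> ?S"
      using E by (auto simp: edges_at_def edges_from_iff star_edges_def edges_from_def)
  qed
  finally show ?case .
qed

section \<open>The state and its cumulants\<close>

text \<open>
  The contraction and the kernel take the arguments of the Green function in opposite orders, so that
  its symmetry is used.
\<close>

lemma contraction_edges:
  assumes "finite L" "fst f \<in> L" "snd f \<in> L" "fst g \<in> L" "snd g \<in> L"
  shows "contraction L (green_function L) (edge_psi f) (edge_psi_bar g) = edge_kernel L f g"
proof -
  have delta: "(\<Sum>w\<in>L. \<Sum>v\<in>L. of_bool (w = x) * green_function L v w * of_bool (v = y)) = green_function L y x"
    if "x \<in> L" "y \<in> L" for x y
    using that assms(1) by (simp add: sum_distrib_right[symmetric] mult.assoc sum_distrib_left[symmetric])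
  have "contraction L (green_function L) (edge_psi f) (edge_psi_bar g) =
      (\<Sum>w\<in>L. \<Sum>v\<in>L. (of_bool (w = snd f) - of_bool (w = fst f)) * green_function L v w *
        (of_bool (v = snd g) - of_bool (v = fst g)))"
    unfolding contraction_def
    by (intro sum.cong refl) (simp add: edge_psi_def edge_psi_bar_def coeff_diff generator.rep_eq)
  also have "\<dots> = (green_function L (snd g) (snd f) - green_function L (snd g) (fst f)) -
      (green_function L (fst g) (snd f) - green_function L (fst g) (fst f))"
    by (simp only: left_diff_distrib right_diff_distrib sum_subtractf delta assms)
  also have "\<dots> = edge_kernel L f g"
    using assms
    by (simp add: edge_kernel_def mixed_difference_def edge_direction_def
        green_function_inverse(2)[of L "snd g"] green_function_inverse(2)[of L "fst g"])
  finally show ?thesis .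
qed

lemma fermionic_gaussian_laplacian:
  "finite L \<Longrightarrow> fermionic_gaussian L (\<lambda>u v. - laplacian u v) (green_function L)"
  by (rule fermionic_gaussian.intro) (assumption, rule green_function_inverse(1))

text \<open>
  The normalization of the state is the total Gaussian integral. That integral is the determinant of the
  transposed matrix, and the Laplacian is symmetric.
\<close>

lemma gff_state_eq:
  assumes "finite L"
  shows "gff_state L F = fermionic_gaussian.gauss_integral L (\<lambda>u v. - laplacian u v) F /
    fermionic_gaussian.gauss_integral L (\<lambda>u v. - laplacian u v) 1"
proof -
  interpret fermionic_gaussian L "\<lambda>u v. - laplacian u v" "green_function L"
    using assms by (rule fermionic_gaussian_laplacian)
  have "gauss_integral 1 = det_on L (\<lambda>u v. - laplacian u v)"
    unfolding gauss_integral_one by (simp add: laplacian_sym)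
  then show ?thesis
    unfolding gff_state_def grassmann_exp_action by (simp add: gauss_integral_def berezin_def)
qed

lemma linear_gff_state: "finite L \<Longrightarrow> linear (gff_state L)"
proof -
  assume L: "finite L"
  interpret fermionic_gaussian L "\<lambda>u v. - laplacian u v" "green_function L"
    using L by (rule fermionic_gaussian_laplacian)
  show ?thesis
    by (intro linearI) (simp_all add: gff_state_eq[OF L] linear_add[OF linear_gauss_integral]
        linear_scale[OF linear_gauss_integral] add_divide_distrib)
qed

lemma gff_state_edge_pairs:
  assumes "finite L" "finite E" "\<And>f. f \<in> E \<Longrightarrow> fst f \<in> L \<and> snd f \<in> L"
  shows "gff_state L (edge_pairs E) = det_on E (edge_kernel L)"
proof -
  interpret fermionic_gaussian L "\<lambda>u v. - laplacian u v" "green_function L"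
    using assms(1) by (rule fermionic_gaussian_laplacian)
  have "gauss_integral (edge_pairs E) = gauss_integral 1 *
      det_on E (\<lambda>f g. contraction L (green_function L) (edge_psi f) (edge_psi_bar g))"
  proof (rule wick[OF assms(2) edge_forms_linear])
    show "edge_psi f \<in> span ((\<lambda>w. generator (Psi w)) ` L)" if "f \<in> E" for f
      unfolding edge_psi_def using assms(3)[OF that] by (intro span_diff span_base) auto
  qed
  moreover have "det_on E (\<lambda>f g. contraction L (green_function L) (edge_psi f) (edge_psi_bar g)) =
      det_on E (edge_kernel L)"
    unfolding det_on_def
  proof (intro sum.cong arg_cong2[of _ _ _ _ "(*)"] prod.cong refl)
    fix p f assume "p \<in> {p. p permutes E}" "f \<in> E"
    then show "contraction L (green_function L) (edge_psi f) (edge_psi_bar (p f)) = edge_kernel L f (p f)"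
      using assms by (intro contraction_edges) (auto simp: permutes_in_image)
  qed
  ultimately show ?thesis
    using gauss_integral_one_nonzero by (simp add: gff_state_eq[OF assms(1)])
qed

text \<open>
  Points in the interior of \<open>L\<close> have all their edges inside \<open>L\<close>, so that Wick's theorem applies. An edge
  set without edges at some point of \<open>B\<close> has weight zero, which leaves the edge sets that
  cover \<open>B\<close>.
\<close>

lemma gff_state_X_Y:
  fixes L B :: "(int ^ 'd) set"
  assumes "finite L" "B \<subseteq> lattice_interior L"
  shows "gff_state L (commuting_prod (\<lambda>v. X_field v * Y_field v) B) =
    (\<Sum>E\<in>star_covering B. (\<Prod>v\<in>B. - 1 / (2 * real CARD('d)) * local_weight (edges_at E v)) *
      det_on E (edge_kernel L))"
proof -
  let ?k = "\<lambda>E. \<Prod>v\<in>B. - 1 / (2 * real CARD('d)) * local_weight (edges_at E v)"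
  have BL: "B \<subseteq> L" using assms(2) by (auto simp: lattice_interior_def)
  then have finB: "finite B" using assms(1) finite_subset by blast
  have ends: "fst f \<in> L \<and> snd f \<in> L" if "f \<in> edges_from B" for f
  proof -
    have "fst f \<in> lattice_interior L" "nearest_neighbours (fst f) (snd f)"
      using that assms(2) by (auto simp: edges_from_iff nearest_neighbours_def)
    then show ?thesis by (auto simp: lattice_interior_def)
  qed
  have "gff_state L (commuting_prod (\<lambda>v. X_field v * Y_field v) B) =
      gff_state L (\<Sum>E\<in>Pow (edges_from B). ?k E *\<^sub>R edge_pairs E)"
    by (subst commuting_prod_star_sums[OF finB X_Y_field_expansion X_Y_field_commute]) simp
  also have "\<dots> = (\<Sum>E\<in>Pow (edges_from B). ?k E * gff_state L (edge_pairs E))"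
    by (simp add: linear_sum[OF linear_gff_state[OF assms(1)]] linear_scale[OF linear_gff_state[OF assms(1)]])
  also have "\<dots> = (\<Sum>E\<in>Pow (edges_from B). ?k E * det_on E (edge_kernel L))"
  proof (intro sum.cong refl arg_cong2[of _ _ _ _ "(*)"] gff_state_edge_pairs assms(1))
    fix E assume "E \<in> Pow (edges_from B)"
    then show "finite E" "\<And>f. f \<in> E \<Longrightarrow> fst f \<in> L \<and> snd f \<in> L"
      using finite_edges_from[OF finB] ends by (auto intro: finite_subset)
  qed
  also have "\<dots> = (\<Sum>E\<in>star_covering B. ?k E * det_on E (edge_kernel L))"
  proof (rule sum.mono_neutral_right)
    show "finite (Pow (edges_from B))" using finite_edges_from[OF finB] by simp
    show "star_covering B \<subseteq> Pow (edges_from B)" by (auto simp: star_covering_def)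
    show "\<forall>E\<in>Pow (edges_from B) - star_covering B. ?k E * det_on E (edge_kernel L) = 0"
    proof
      fix E assume "E \<in> Pow (edges_from B) - star_covering B"
      then obtain v where "v \<in> B" "card (edges_at E v) = 0"
        by (auto simp: star_covering_def not_le)
      then have "?k E = 0" using finB by (auto simp: local_weight_def intro!: prod_zero bexI[of _ v])
      then show "?k E * det_on E (edge_kernel L) = 0" by (simp only: mult_zero_left)
    qed
  qed
  finally show ?thesis .
qed

theorem theorem3p5:
  fixes L V :: "(int ^ 'd) set" and n :: nat
  assumes "CARD('d) \<ge> 2"
    and "finite L" and "lattice_connected L"
    and "n \<ge> 1"
    and "V \<subseteq> lattice_interior L" and "card V = n" and "good_set L V"
  shows "gff_cumulant L (\<lambda>v. X_field v * Y_field v) V =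
    (- 1 / (2 * real CARD('d))) ^ n *
    (\<Sum>E | E \<subseteq> edges_from V \<and> (\<forall>v\<in>V. card (edges_at E v) \<ge> 1).
      edge_set_weight V E *
      (\<Sum>\<tau>\<in>connected_permutations V E.
        of_int (sign \<tau>) * (\<Prod>f\<in>E. edge_kernel L f (\<tau> f))))"
proof -
  let ?c = "- 1 / (2 * real CARD('d))"
  let ?perms = "\<lambda>E. \<Sum>\<tau>\<in>connected_permutations V E. of_int (sign \<tau>) * (\<Prod>f\<in>E. edge_kernel L f (\<tau> f))"
  have V: "finite V" "V \<noteq> {}"
    using assms(4,6) card_gt_0_iff[of V] by auto
  have "gff_cumulant L (\<lambda>v. X_field v * Y_field v) V =
      (\<Sum>P | partition_on V P. moebius_weight P *
        (\<Prod>B\<in>P. gff_state L (commuting_prod (\<lambda>v. X_field v * Y_field v) B)))"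
    by (simp add: gff_cumulant_def moebius_weight_def)
  also have "\<dots> = (\<Sum>P | partition_on V P. moebius_weight P *
      (\<Prod>B\<in>P. \<Sum>E\<in>star_covering B. (\<Prod>v\<in>B. ?c * local_weight (edges_at E v)) *
        det_on E (edge_kernel L)))"
  proof (intro sum.cong refl arg_cong2[of _ _ _ _ "(*)"] prod.cong gff_state_X_Y assms(2))
    fix P B assume "P \<in> {P. partition_on V P}" "B \<in> P"
    then show "B \<subseteq> lattice_interior L" using assms(5) by (auto simp: partition_on_def)
  qed
  also have "\<dots> = (\<Sum>E\<in>star_covering V. (\<Prod>v\<in>V. ?c * local_weight (edges_at E v)) * ?perms E)"
    by (rule determinantal_cumulant[OF V, of "\<lambda>F. ?c * local_weight F"])
  also have "\<dots> = ?c ^ n * (\<Sum>E\<in>star_covering V. edge_set_weight V E * ?perms E)"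
  proof -
    have "(\<Prod>v\<in>V. ?c * local_weight (edges_at E v)) = ?c ^ n * edge_set_weight V E" for E
      by (simp only: prod.distrib prod_constant edge_set_weight_def assms(6))
    then show ?thesis by (simp only: mult.assoc sum_distrib_left[of "?c ^ n", symmetric])
  qed
  finally show ?thesis by (simp only: star_covering_def)
qed

end
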